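(* Let $S_n=(\mathcal{V},(m_i)_{0\le i\le n-1})$ be a locally finite weighted oriented $n$-simplicial complex and let $0\le\ell\le n-1$. Assume: (i) there exist finite sets $O_k\subset\mathcal{V}$ ($k\ge1$) with $O_k\nearrow\mathcal{V}$ and functions $\chi_k:\mathcal{V}\to[0,1]$ such that, for every $k$, $\chi_k$ has finite support and $\chi_k(x)=1$ for every $x\in O_k$; (ii) if $\ell\ge1$, then $\sup_\sigma d_{m_{\ell-1}}(\sigma)<\infty$ (supremum over $(\ell-1)$-simplices), and if $\ell\le n-2$, then $\sup_\sigma d_{m_\ell}(\sigma)<\infty$ (supremum over $\ell$-simplices). Then $L_\ell=d_{\ell-1}\delta_\ell+\delta_{\ell+1}d_\ell$ (with the conventions $\delta_0=0$ and $d_{n-1}=0$) is essentially self-adjoint on $C_c^\ell(\mathcal{V})$, as an operator in $\ell^2(m_\ell)$. In particular, if $1\le\ell\le n-1$, $S_n$ is locally $\chi$-complete at level $\ell$ and the weighted-degree bounds in (ii) hold, then $L_\ell$ is essentially self-adjoint on $C_c^\ell(\mathcal{V})$.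
   Context: Complex. $\mathcal{V}$ is a countable set, $m_0:\mathcal{V}\to(0,\infty)$, and $m_1:\mathcal{V}\times\mathcal{V}\to[0,\infty)$ is symmetric with $m_1(x,x)=0$. Write $x\sim y$ (neighbours) if $m_1(x,y)>0$. Locally finite means every vertex has finitely many neighbours. Fix an integer $n\ge2$. For $0\le i\le n-1$, $\mathcal{F}_i$ is the set of ordered tuples $(x_0,\dots,x_i)$ of pairwise adjacent vertices (cliques); these are the $i$-simplices. $P_i$ is the quotient of $\mathcal{F}_i$ by even permutations; $-\tau$ denotes the opposite orientation of $\tau\in P_i$. The weights $m_i:\mathcal{V}^{i+1}\to[0,\infty)$, $0\le i\le n-1$, are invariant under all permutations and positive exactly on $\mathcal{F}_i$. $S_n=(\mathcal{V},(m_i)_{0\le i\le n-1})$ is the weighted oriented $n$-simplicial complex (simplices have at most $n$ vertices). For $1\le i\le n-1$ and an $(i-1)$-simplex, $F(x_0,\dots,x_{i-1})$ is the set of common neighbours of $x_0,\dots,x_{i-1}$, and the weighted degree is $$d_{m_{i-1}}(x_0,\dots,x_{i-1})=\frac1{m_{i-1}(x_0,\dots,x_{i-1})}\sum_{x_i\in F(x_0,\dots,x_{i-1})}m_i(x_0,\dots,x_i).$$ Cochains. $C_c^i(\mathcal{V})$ is the space of finitely supported $f:P_i\to\mathbb{C}$ with $f(-\tau)=-f(\tau)$ (alternating functions on $\mathcal{F}_i$), with inner product $\langle f,g\rangle_{\ell^2(m_i)}=\frac1{(i+1)!}\sum_{(x_0,\dots,x_i)\in\mathcal{F}_i}m_i(x_0,\dots,x_i)\overline{f(x_0,\dots,x_i)}g(x_0,\dots,x_i)$;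 $\ell^2(m_i)$ is its completion. Operators. For $0\le i\le n-2$, $d_i:C_c^i(\mathcal{V})\to C_c^{i+1}(\mathcal{V})$, $d_if(x_0,\dots,x_{i+1})=\sum_{j=0}^{i+1}(-1)^jf(x_0,\dots,\widehat{x_j},\dots,x_{i+1})$. For $1\le i\le n-1$, $\delta_i:C_c^i(\mathcal{V})\to C_c^{i-1}(\mathcal{V})$, $$\delta_ig(x_0,\dots,x_{i-1})=\frac{(-1)^i}{m_{i-1}(x_0,\dots,x_{i-1})}\sum_{x_i\in F(x_0,\dots,x_{i-1})}m_i(x_0,\dots,x_i)g(x_0,\dots,x_i).$$ Local $\chi$-completeness. $O_k\nearrow\mathcal{V}$ means the $O_k$ increase with union $\mathcal{V}$. For $\chi:\mathcal{V}\to[0,1]$ and $1\le\ell\le n-1$ the energy at level $\ell$ is $$E_\ell(\chi)=\frac1{\ell!}\sum_{(x_0,\dots,x_{\ell-1})\in P_{\ell-1}^+}\frac1{m_{\ell-1}(x_0,\dots,x_{\ell-1})}\sum_{x_\ell\in F(x_0,\dots,x_{\ell-1})}m_\ell(x_0,\dots,x_\ell)\sum_{j=0}^\ell|a_j|^2,$$ where $P_{\ell-1}^+$ contains exactly one orientation of each $(\ell-1)$-simplex and $a_j=\frac{S-(\ell+1)\chi(x_j)}{\ell(\ell+1)}$, $S=\sum_{k=0}^\ell\chi(x_k)$. For $1\le\ell\le n-1$, $S_n$ is locally $\chi$-complete at level $\ell$ if there are finite sets $O_k\nearrow\mathcal{V}$, functions $\chi_k:\mathcal{V}\to[0,1]$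 and a constant $C>0$ such that for all $k$: $\chi_k$ has finite support, $\chi_k=1$ on $O_k$, and $E_\ell(\chi_k)\le C$ (for this single $\ell$). *)

theory Defs
  imports "HOL-Analysis.Analysis" "HOL-Combinatorics.Permutations"
begin

section \<open>Weighted oriented simplicial complexes\<close>

text \<open>
  A tuple \<open>(x\<^sub>0, \<dots>, x\<^sub>i)\<close> is the list \<open>[x\<^sub>0, \<dots>, x\<^sub>i]\<close>, and \<open>m i\<close> is the weight
  \<open>m\<^sub>i\<close>; its values on lists of length other than \<open>i + 1\<close> or with entries outside \<open>V\<close>
  play no role.
\<close>

definition adjacent :: "'v set \<Rightarrow> (nat \<Rightarrow> 'v list \<Rightarrow> real) \<Rightarrow> 'v \<Rightarrow> 'v \<Rightarrow> bool" where
  "adjacent V m x y \<longleftrightarrow> x \<in> V \<and> y \<in> V \<and> m 1 [x, y] > 0"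

definition simplices :: "'v set \<Rightarrow> (nat \<Rightarrow> 'v list \<Rightarrow> real) \<Rightarrow> nat \<Rightarrow> 'v list set" where
  "simplices V m i = {xs. length xs = i + 1 \<and> set xs \<subseteq> V \<and>
     (\<forall>j<length xs. \<forall>k<length xs. j \<noteq> k \<longrightarrow> adjacent V m (xs ! j) (xs ! k))}"

definition even_perm_rel ::
  "'v set \<Rightarrow> (nat \<Rightarrow> 'v list \<Rightarrow> real) \<Rightarrow> nat \<Rightarrow> ('v list \<times> 'v list) set" where
  "even_perm_rel V m i = {(xs, permute_list p xs) | xs p.
     xs \<in> simplices V m i \<and> p permutes {..<i + 1} \<and> evenperm p}"

definition oriented_simplices ::
  "'v set \<Rightarrow> (nat \<Rightarrow> 'v list \<Rightarrow> real) \<Rightarrow> nat \<Rightarrow> 'v list set set" where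
  "oriented_simplices V m i = simplices V m i // even_perm_rel V m i"

text \<open>
  \<open>Pos i\<close> is \<open>P\<^sub>i\<^sup>+\<close>: it selects exactly one orientation of each \<open>i\<close>-simplex, an unoriented
  simplex being determined by its set of vertices.
\<close>

locale weighted_oriented_complex =
  fixes V :: "'v set"
    and n :: nat
    and m :: "nat \<Rightarrow> 'v list \<Rightarrow> real"
    and Pos :: "nat \<Rightarrow> 'v list set set"
  assumes countable_V: "countable V"
    and n_ge_2: "n \<ge> 2"
    and weight_nonneg: "\<And>i xs. i \<le> n - 1 \<Longrightarrow> length xs = i + 1 \<Longrightarrow> set xs \<subseteq> V \<Longrightarrow> m i xs \<ge> 0"
    and weight_perm: "\<And>i xs p. i \<le> n - 1 \<Longrightarrow> length xs = i + 1 \<Longrightarrow> set xs \<subseteq> V \<Longrightarrow>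
          p permutes {..<i + 1} \<Longrightarrow> m i (permute_list p xs) = m i xs"
    and weight_pos_iff: "\<And>i xs. i \<le> n - 1 \<Longrightarrow> length xs = i + 1 \<Longrightarrow> set xs \<subseteq> V \<Longrightarrow>
          m i xs > 0 \<longleftrightarrow> xs \<in> simplices V m i"
    and no_loops: "\<And>x. x \<in> V \<Longrightarrow> m 1 [x, x] = 0"
    and Pos_oriented: "\<And>i. i \<le> n - 1 \<Longrightarrow> Pos i \<subseteq> oriented_simplices V m i"
    and Pos_unique: "\<And>i xs. i \<le> n - 1 \<Longrightarrow> xs \<in> simplices V m i \<Longrightarrow>
          \<exists>!\<tau>. \<tau> \<in> Pos i \<and> (\<exists>ys\<in>\<tau>. set ys = set xs)"

definition locally_finite_complex :: "'v set \<Rightarrow> (nat \<Rightarrow> 'v list \<Rightarrow> real) \<Rightarrow> bool" where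
  "locally_finite_complex V m \<longleftrightarrow> (\<forall>x\<in>V. finite {y. adjacent V m x y})"

definition common_neighbours ::
  "'v set \<Rightarrow> (nat \<Rightarrow> 'v list \<Rightarrow> real) \<Rightarrow> 'v list \<Rightarrow> 'v set" where
  "common_neighbours V m xs = {y \<in> V. \<forall>x\<in>set xs. adjacent V m x y}"

definition weighted_degree ::
  "'v set \<Rightarrow> (nat \<Rightarrow> 'v list \<Rightarrow> real) \<Rightarrow> nat \<Rightarrow> 'v list \<Rightarrow> real" where
  "weighted_degree V m i xs =
     1 / m i xs * (\<Sum>y\<in>common_neighbours V m xs. m (i + 1) (xs @ [y]))"


section \<open>Cochains\<close>

type_synonym 'v cochain = "'v list \<Rightarrow> complex"

text \<open>
  Functions \<open>f\<close> on \<open>P\<^sub>i\<close> with \<open>f (-\<tau>) = - f \<tau>\<close> are alternating functions of \<open>i\<close>-simplices;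
  they are extended by \<open>0\<close> to all lists, so that equality of cochains is equality of functions.
\<close>

definition alternating ::
  "'v set \<Rightarrow> (nat \<Rightarrow> 'v list \<Rightarrow> real) \<Rightarrow> nat \<Rightarrow> 'v cochain \<Rightarrow> bool" where
  "alternating V m i f \<longleftrightarrow>
     (\<forall>xs. xs \<notin> simplices V m i \<longrightarrow> f xs = 0) \<and>
     (\<forall>xs p. xs \<in> simplices V m i \<longrightarrow> p permutes {..<i + 1} \<longrightarrow>
        f (permute_list p xs) = of_int (sign p) * f xs)"

definition Cc :: "'v set \<Rightarrow> (nat \<Rightarrow> 'v list \<Rightarrow> real) \<Rightarrow> nat \<Rightarrow> 'v cochain set" where
  "Cc V m i = {f. alternating V m i f \<and> finite {xs. f xs \<noteq> 0}}"

text \<open>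
  The completion of \<open>Cc V m i\<close> is realised as usual by the square-summable alternating functions.
\<close>

definition ell2 :: "'v set \<Rightarrow> (nat \<Rightarrow> 'v list \<Rightarrow> real) \<Rightarrow> nat \<Rightarrow> 'v cochain set" where
  "ell2 V m i = {f. alternating V m i f \<and>
     (\<lambda>xs. m i xs * (cmod (f xs))\<^sup>2) summable_on simplices V m i}"

definition ell2_inner ::
  "'v set \<Rightarrow> (nat \<Rightarrow> 'v list \<Rightarrow> real) \<Rightarrow> nat \<Rightarrow> 'v cochain \<Rightarrow> 'v cochain \<Rightarrow> complex" where
  "ell2_inner V m i f g =
     1 / fact (i + 1) *
     (\<Sum>\<^sub>\<infinity>xs\<in>simplices V m i. complex_of_real (m i xs) * cnj (f xs) * g xs)"


section \<open>Coboundary, its formal adjoint, and the Laplacian\<close>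

definition delete_nth :: "nat \<Rightarrow> 'a list \<Rightarrow> 'a list" where
  "delete_nth j xs = take j xs @ drop (Suc j) xs"

definition coboundary ::
  "'v set \<Rightarrow> (nat \<Rightarrow> 'v list \<Rightarrow> real) \<Rightarrow> nat \<Rightarrow> 'v cochain \<Rightarrow> 'v cochain" where
  "coboundary V m i f = (\<lambda>xs. if xs \<in> simplices V m (i + 1)
     then (\<Sum>j\<le>i + 1. (-1) ^ j * f (delete_nth j xs)) else 0)"

text \<open>\<open>codiff V m i\<close> is \<open>\<delta>\<^sub>i\<close>; it is only used for \<open>i \<ge> 1\<close>.\<close>

definition codiff ::
  "'v set \<Rightarrow> (nat \<Rightarrow> 'v list \<Rightarrow> real) \<Rightarrow> nat \<Rightarrow> 'v cochain \<Rightarrow> 'v cochain" where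
  "codiff V m i g = (\<lambda>xs. if xs \<in> simplices V m (i - 1)
     then (-1) ^ i / complex_of_real (m (i - 1) xs) *
       (\<Sum>y\<in>common_neighbours V m xs. complex_of_real (m i (xs @ [y])) * g (xs @ [y]))
     else 0)"

definition laplacian ::
  "'v set \<Rightarrow> nat \<Rightarrow> (nat \<Rightarrow> 'v list \<Rightarrow> real) \<Rightarrow> nat \<Rightarrow> 'v cochain \<Rightarrow> 'v cochain" where
  "laplacian V n m l f = (\<lambda>xs.
     (if l = 0 then 0 else coboundary V m (l - 1) (codiff V m l f) xs) +
     (if l = n - 1 then 0 else codiff V m (l + 1) (coboundary V m l f) xs))"


section \<open>Unbounded operators on a Hilbert space of functions\<close>

text \<open>
  The Hilbert space is given by a carrier \<open>H\<close> of functions and an inner product \<open>ip\<close> that is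
  conjugate-linear in its first argument. Operators are represented by their graphs.
\<close>

definition converges_to ::
  "(('a \<Rightarrow> complex) \<Rightarrow> ('a \<Rightarrow> complex) \<Rightarrow> complex) \<Rightarrow>
   (nat \<Rightarrow> 'a \<Rightarrow> complex) \<Rightarrow> ('a \<Rightarrow> complex) \<Rightarrow> bool" where
  "converges_to ip u f \<longleftrightarrow>
     (\<lambda>k. sqrt (Re (ip (\<lambda>x. u k x - f x) (\<lambda>x. u k x - f x)))) \<longlonglongrightarrow> 0"

definition dense_subset ::
  "('a \<Rightarrow> complex) set \<Rightarrow> (('a \<Rightarrow> complex) \<Rightarrow> ('a \<Rightarrow> complex) \<Rightarrow> complex) \<Rightarrow>
   ('a \<Rightarrow> complex) set \<Rightarrow> bool" where
  "dense_subset H ip D \<longleftrightarrow> D \<subseteq> H \<and>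
     (\<forall>f\<in>H. \<exists>u. (\<forall>k. u k \<in> D) \<and> converges_to ip u f)"

definition closure_graph ::
  "('a \<Rightarrow> complex) set \<Rightarrow> (('a \<Rightarrow> complex) \<Rightarrow> ('a \<Rightarrow> complex) \<Rightarrow> complex) \<Rightarrow>
   (('a \<Rightarrow> complex) \<times> ('a \<Rightarrow> complex)) set \<Rightarrow>
   (('a \<Rightarrow> complex) \<times> ('a \<Rightarrow> complex)) set" where
  "closure_graph H ip G = {(f, g). f \<in> H \<and> g \<in> H \<and>
     (\<exists>u v. (\<forall>k. (u k, v k) \<in> G) \<and> converges_to ip u f \<and> converges_to ip v g)}"

definition adjoint_graph ::
  "('a \<Rightarrow> complex) set \<Rightarrow> (('a \<Rightarrow> complex) \<Rightarrow> ('a \<Rightarrow> complex) \<Rightarrow> complex) \<Rightarrow>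
   (('a \<Rightarrow> complex) \<times> ('a \<Rightarrow> complex)) set \<Rightarrow>
   (('a \<Rightarrow> complex) \<times> ('a \<Rightarrow> complex)) set" where
  "adjoint_graph H ip G = {(g, h). g \<in> H \<and> h \<in> H \<and> (\<forall>(f, Tf)\<in>G. ip g Tf = ip h f)}"

text \<open>Graphs of densely defined linear operators in \<open>H\<close>.\<close>

definition densely_defined_operator ::
  "('a \<Rightarrow> complex) set \<Rightarrow> (('a \<Rightarrow> complex) \<Rightarrow> ('a \<Rightarrow> complex) \<Rightarrow> complex) \<Rightarrow>
   (('a \<Rightarrow> complex) \<times> ('a \<Rightarrow> complex)) set \<Rightarrow> bool" where
  "densely_defined_operator H ip G \<longleftrightarrow>
     G \<subseteq> H \<times> H \<and> single_valued G \<and> dense_subset H ip (Domain G) \<and>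
     (\<lambda>x. 0, \<lambda>x. 0) \<in> G \<and>
     (\<forall>a f Tf g Tg. (f, Tf) \<in> G \<longrightarrow> (g, Tg) \<in> G \<longrightarrow>
        (\<lambda>x. a * f x + g x, \<lambda>x. a * Tf x + Tg x) \<in> G)"

definition self_adjoint ::
  "('a \<Rightarrow> complex) set \<Rightarrow> (('a \<Rightarrow> complex) \<Rightarrow> ('a \<Rightarrow> complex) \<Rightarrow> complex) \<Rightarrow>
   (('a \<Rightarrow> complex) \<times> ('a \<Rightarrow> complex)) set \<Rightarrow> bool" where
  "self_adjoint H ip G \<longleftrightarrow> densely_defined_operator H ip G \<and> adjoint_graph H ip G = G"

text \<open>
  The operator \<open>T\<close> with domain \<open>D\<close> is essentially self-adjoint: it is a densely defined operator
  in \<open>H\<close> whose closure is a self-adjoint operator; since a self-adjoint operator is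
  single-valued, closability is included.
\<close>

definition essentially_self_adjoint_on ::
  "('a \<Rightarrow> complex) set \<Rightarrow> (('a \<Rightarrow> complex) \<Rightarrow> ('a \<Rightarrow> complex) \<Rightarrow> complex) \<Rightarrow>
   ('a \<Rightarrow> complex) set \<Rightarrow> (('a \<Rightarrow> complex) \<Rightarrow> ('a \<Rightarrow> complex)) \<Rightarrow> bool" where
  "essentially_self_adjoint_on H ip D T \<longleftrightarrow>
     densely_defined_operator H ip {(f, T f) | f. f \<in> D} \<and>
     self_adjoint H ip (closure_graph H ip {(f, T f) | f. f \<in> D})"


section \<open>Local \<open>\<chi>\<close>-completeness\<close>

definition exhaustion_with_cutoffs ::
  "'v set \<Rightarrow> (nat \<Rightarrow> 'v set) \<Rightarrow> (nat \<Rightarrow> 'v \<Rightarrow> real) \<Rightarrow> bool" where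
  "exhaustion_with_cutoffs V Ok chi \<longleftrightarrow>
     (\<forall>k. finite (Ok k)) \<and> incseq Ok \<and> (\<Union>k. Ok k) = V \<and>
     (\<forall>k. \<forall>x\<in>V. chi k x \<in> {0..1}) \<and>
     (\<forall>k. finite {x \<in> V. chi k x \<noteq> 0}) \<and>
     (\<forall>k. \<forall>x\<in>Ok k. chi k x = 1)"

text \<open>The coefficient \<open>a\<^sub>j\<close> of the \<open>l\<close>-simplex \<open>xs = [x\<^sub>0, \<dots>, x\<^sub>l]\<close>.\<close>

definition energy_coeff :: "nat \<Rightarrow> ('v \<Rightarrow> real) \<Rightarrow> 'v list \<Rightarrow> nat \<Rightarrow> real" where
  "energy_coeff l chi xs j =
     ((\<Sum>k\<le>l. chi (xs ! k)) - real (l + 1) * chi (xs ! j)) / (real l * real (l + 1))"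

definition energy_density ::
  "'v set \<Rightarrow> (nat \<Rightarrow> 'v list \<Rightarrow> real) \<Rightarrow> nat \<Rightarrow> ('v \<Rightarrow> real) \<Rightarrow> 'v list \<Rightarrow> real" where
  "energy_density V m l chi xs =
     1 / m (l - 1) xs *
     (\<Sum>y\<in>common_neighbours V m xs.
        m l (xs @ [y]) * (\<Sum>j\<le>l. \<bar>energy_coeff l chi (xs @ [y]) j\<bar>\<^sup>2))"

text \<open>
  The density does not depend on the order of the vertices, so it may be evaluated at any
  representative of an oriented simplex. Summing in \<^typ>\<open>ennreal\<close> excludes spurious values
  of a divergent sum.
\<close>

definition energy ::
  "'v set \<Rightarrow> (nat \<Rightarrow> 'v list \<Rightarrow> real) \<Rightarrow> (nat \<Rightarrow> 'v list set set) \<Rightarrow> nat \<Rightarrow>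
   ('v \<Rightarrow> real) \<Rightarrow> ennreal" where
  "energy V m Pos l chi = ennreal (1 / fact l) *
     (\<Sum>\<^sub>\<infinity>\<tau>\<in>Pos (l - 1). ennreal (energy_density V m l chi (SOME xs. xs \<in> \<tau>)))"

definition locally_chi_complete ::
  "'v set \<Rightarrow> (nat \<Rightarrow> 'v list \<Rightarrow> real) \<Rightarrow> (nat \<Rightarrow> 'v list set set) \<Rightarrow> nat \<Rightarrow> bool" where
  "locally_chi_complete V m Pos l \<longleftrightarrow>
     (\<exists>Ok chi. \<exists>C>0. exhaustion_with_cutoffs V Ok chi \<and>
        (\<forall>k. energy V m Pos l (chi k) \<le> ennreal C))"

end

theory Submission
  imports Defs
begin

text \<open>
  Under the degree bounds the Laplacian is a bounded operator, and a bounded symmetric operator on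
  a dense subspace is essentially self-adjoint: its closure is the continuous extension to the
  whole space, which is symmetric and everywhere defined, hence self-adjoint. The domain \<open>Cc\<close> is dense
  because restricting a square-summable cochain to the simplices with all vertices in the finite set
  \<open>O\<^sub>k\<close> gives finitely supported cochains that converge to it (\<open>Cc_dense\<close>).

  By local finiteness the formulas for \<open>d\<close>, \<open>\<delta>\<close> and \<open>L\<close> make sense for arbitrary cochains, and the
  continuous extension of \<open>L\<close> to \<open>\<ell>\<^sup>2\<close> is given by the same formula. It is therefore enough that \<open>d\<^sub>i\<close> and \<open>\<delta>\<^sub>i\<^sub>+\<^sub>1\<close> are bounded and adjoint to each other
  between the full spaces \<open>\<ell>\<^sup>2(m\<^sub>i)\<close> and \<open>\<ell>\<^sup>2(m\<^sub>i\<^sub>+\<^sub>1)\<close> whenever the degree of \<open>i\<close>-simplices is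
  bounded by some \<open>D\<close> (\<open>coboundary_codiff_adjoint_pair\<close>); then \<open>d \<delta>\<close> and \<open>\<delta> d\<close> are bounded and
  symmetric.

  These facts come from two rearrangements of sums over \<open>(i + 1)\<close>-simplices. Splitting off the last
  vertex writes such a sum as a sum over \<open>i\<close>-simplices \<open>ys\<close> and common neighbours \<open>y\<close> of \<open>ys\<close>
  (\<open>infsum_snoc\<close>); summing the weight \<open>m\<^sub>i\<^sub>+\<^sub>1\<close> over \<open>y\<close> alone yields the weighted degree. Moving
  the \<open>j\<close>-th vertex to the last position permutes the \<open>(i + 1)\<close>-simplices, keeps the weight, and
  multiplies an alternating function by a sign; it turns the \<open>j\<close>-th face into the face opposite to
  the last vertex. Each of the \<open>i + 2\<close> terms of \<open>d f\<close> thus contributes the same as the last one, and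
  that one is handled by the first rearrangement. The bound for \<open>\<delta>\<close> is the Cauchy-Schwarz
  inequality over the common neighbours.
\<close>

section \<open>Bounded symmetric operators on spaces of functions\<close>

text \<open>
  The Hilbert spaces are sets of functions, not types, so the axioms are relative to a carrier. The
  single operation \<open>a f + g\<close> covers all linear combinations.
\<close>

locale function_inner_product =
  fixes H :: "('a \<Rightarrow> complex) set"
    and ip :: "('a \<Rightarrow> complex) \<Rightarrow> ('a \<Rightarrow> complex) \<Rightarrow> complex"
  assumes zero_mem: "(\<lambda>x. 0) \<in> H"
    and lin_mem: "f \<in> H \<Longrightarrow> g \<in> H \<Longrightarrow> (\<lambda>x. a * f x + g x) \<in> H"
    and ip_lin: "f \<in> H \<Longrightarrow> g \<in> H \<Longrightarrow> h \<in> H \<Longrightarrow> ip h (\<lambda>x. a * f x + g x) = a * ip h f + ip h g"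
    and ip_cnj: "f \<in> H \<Longrightarrow> g \<in> H \<Longrightarrow> ip g f = cnj (ip f g)"
    and ip_pos: "f \<in> H \<Longrightarrow> Re (ip f f) \<ge> 0"
    and ip_definite: "f \<in> H \<Longrightarrow> Re (ip f f) = 0 \<Longrightarrow> f = (\<lambda>x. 0)"
begin

abbreviation sq :: "('a \<Rightarrow> complex) \<Rightarrow> real" where
  "sq f \<equiv> Re (ip f f)"

lemma add_mem: "f \<in> H \<Longrightarrow> g \<in> H \<Longrightarrow> (\<lambda>x. f x + g x) \<in> H"
  using lin_mem[of f g 1] by simp

lemma diff_mem: "f \<in> H \<Longrightarrow> g \<in> H \<Longrightarrow> (\<lambda>x. f x - g x) \<in> H"
  using lin_mem[of g f "-1"] by simp

lemma ip_add_right: "f \<in> H \<Longrightarrow> g \<in> H \<Longrightarrow> h \<in> H \<Longrightarrow> ip h (\<lambda>x. f x + g x) = ip h f + ip h g"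
  using ip_lin[of f g h 1] by simp

lemma ip_diff_right: "f \<in> H \<Longrightarrow> g \<in> H \<Longrightarrow> h \<in> H \<Longrightarrow> ip h (\<lambda>x. f x - g x) = ip h f - ip h g"
  using ip_lin[of g f h "-1"] by simp

lemma ip_add_left: "f \<in> H \<Longrightarrow> g \<in> H \<Longrightarrow> h \<in> H \<Longrightarrow> ip (\<lambda>x. f x + g x) h = ip f h + ip g h"
  using ip_cnj[of h "\<lambda>x. f x + g x"] ip_cnj[of h f] ip_cnj[of h g]
  by (simp add: add_mem ip_add_right)

lemma ip_diff_left: "f \<in> H \<Longrightarrow> g \<in> H \<Longrightarrow> h \<in> H \<Longrightarrow> ip (\<lambda>x. f x - g x) h = ip f h - ip g h"
  using ip_cnj[of h "\<lambda>x. f x - g x"] ip_cnj[of h f] ip_cnj[of h g]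
  by (simp add: diff_mem ip_diff_right)

lemma ip_zero_right: "h \<in> H \<Longrightarrow> ip h (\<lambda>x. 0) = 0"
  using ip_diff_right[of h h h] by simp

text \<open>
  From the parallelogram law; this is the form of the triangle inequality that suits squared norms.
\<close>

lemma sq_add_le:
  assumes "f \<in> H" "g \<in> H"
  shows "sq (\<lambda>x. f x + g x) \<le> 2 * sq f + 2 * sq g"
proof -
  have "sq (\<lambda>x. f x - g x) \<ge> 0"
    by (intro ip_pos diff_mem assms)
  moreover have "sq (\<lambda>x. f x + g x) + sq (\<lambda>x. f x - g x) = 2 * sq f + 2 * sq g"
    using assms by (simp add: ip_add_right ip_diff_right ip_add_left ip_diff_left add_mem diff_mem)
  ultimately show ?thesis
    by linarith
qed

lemma sq_minus_commute:
  assumes "f \<in> H" "g \<in> H"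
  shows "sq (\<lambda>x. f x - g x) = sq (\<lambda>x. g x - f x)"
  using assms by (simp add: ip_diff_right ip_diff_left diff_mem)

lemma converges_to_iff:
  assumes "\<And>k. u k \<in> H" "f \<in> H"
  shows "converges_to ip u f \<longleftrightarrow> (\<lambda>k. sq (\<lambda>x. u k x - f x)) \<longlonglongrightarrow> 0"
proof
  assume "converges_to ip u f"
  then have "(\<lambda>k. sqrt (sq (\<lambda>x. u k x - f x)) ^ 2) \<longlonglongrightarrow> 0 ^ 2"
    unfolding converges_to_def by (rule tendsto_power)
  then show "(\<lambda>k. sq (\<lambda>x. u k x - f x)) \<longlonglongrightarrow> 0"
    using assms by (simp add: ip_pos diff_mem)
next
  assume "(\<lambda>k. sq (\<lambda>x. u k x - f x)) \<longlonglongrightarrow> 0"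
  then have "(\<lambda>k. sqrt (sq (\<lambda>x. u k x - f x))) \<longlonglongrightarrow> sqrt 0"
    by (rule tendsto_real_sqrt)
  then show "converges_to ip u f"
    unfolding converges_to_def by simp
qed

lemma converges_to_const: "f \<in> H \<Longrightarrow> converges_to ip (\<lambda>k. f) f"
  by (simp add: converges_to_def ip_zero_right zero_mem)

lemma converges_to_unique:
  assumes u: "\<And>k. u k \<in> H" and "f \<in> H" "g \<in> H"
    and "converges_to ip u f" "converges_to ip u g"
  shows "f = g"
proof -
  have "(\<lambda>k. 2 * sq (\<lambda>x. u k x - f x) + 2 * sq (\<lambda>x. u k x - g x)) \<longlonglongrightarrow> 2 * 0 + 2 * 0"
    using assms by (intro tendsto_intros) (simp_all add: converges_to_iff)
  moreover have "sq (\<lambda>x. f x - g x) \<le> 2 * sq (\<lambda>x. u k x - f x) + 2 * sq (\<lambda>x. u k x - g x)" for k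
    using sq_add_le[of "\<lambda>x. f x - u k x" "\<lambda>x. u k x - g x"] assms(2,3) u[of k]
    by (simp add: diff_mem sq_minus_commute[of f])
  ultimately have "sq (\<lambda>x. f x - g x) \<le> 2 * 0 + 2 * 0"
    by (intro LIMSEQ_le_const) auto
  then have "sq (\<lambda>x. f x - g x) = 0"
    using ip_pos[OF diff_mem[OF assms(2,3)]] by linarith
  then have "(\<lambda>x. f x - g x) = (\<lambda>x. 0)"
    by (rule ip_definite[OF diff_mem[OF assms(2,3)]])
  then show ?thesis
    by (simp add: fun_eq_iff)
qed

end

text \<open>
  \<open>S\<close> and \<open>T\<close> act between two different spaces because the prime example is \<open>d\<close> and \<open>\<delta>\<close>. The bounds
  are on squared norms. With \<open>S = T\<close> this is a bounded symmetric operator, so that composing a pair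
  with its swap gives the symmetry of \<open>\<delta> d\<close> and \<open>d \<delta>\<close> at once.
\<close>

locale bounded_adjoint_pair =
  fixes H :: "('a \<Rightarrow> complex) set"
    and ip :: "('a \<Rightarrow> complex) \<Rightarrow> ('a \<Rightarrow> complex) \<Rightarrow> complex"
    and K :: "('b \<Rightarrow> complex) set"
    and ip' :: "('b \<Rightarrow> complex) \<Rightarrow> ('b \<Rightarrow> complex) \<Rightarrow> complex"
    and S :: "('a \<Rightarrow> complex) \<Rightarrow> ('b \<Rightarrow> complex)"
    and T :: "('b \<Rightarrow> complex) \<Rightarrow> ('a \<Rightarrow> complex)"
  assumes S_mem: "f \<in> H \<Longrightarrow> S f \<in> K"
    and T_mem: "g \<in> K \<Longrightarrow> T g \<in> H"
    and S_lin: "f \<in> H \<Longrightarrow> f' \<in> H \<Longrightarrow> S (\<lambda>x. a * f x + f' x) = (\<lambda>x. a * S f x + S f' x)"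
    and T_lin: "g \<in> K \<Longrightarrow> g' \<in> K \<Longrightarrow> T (\<lambda>x. a * g x + g' x) = (\<lambda>x. a * T g x + T g' x)"
    and S_bounded: "\<exists>C\<ge>0. \<forall>f\<in>H. Re (ip' (S f) (S f)) \<le> C * Re (ip f f)"
    and T_bounded: "\<exists>C\<ge>0. \<forall>g\<in>K. Re (ip (T g) (T g)) \<le> C * Re (ip' g g)"
    and adjoint: "f \<in> H \<Longrightarrow> g \<in> K \<Longrightarrow> ip' g (S f) = ip (T g) f"

abbreviation bounded_symmetric ::
  "('a \<Rightarrow> complex) set \<Rightarrow> (('a \<Rightarrow> complex) \<Rightarrow> ('a \<Rightarrow> complex) \<Rightarrow> complex) \<Rightarrow>
   (('a \<Rightarrow> complex) \<Rightarrow> ('a \<Rightarrow> complex)) \<Rightarrow> bool" where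
  "bounded_symmetric H ip T \<equiv> bounded_adjoint_pair H ip H ip T T"

lemma bounded_adjoint_pair_swap:
  assumes "function_inner_product H ip" "function_inner_product K ip'"
    and "bounded_adjoint_pair H ip K ip' S T"
  shows "bounded_adjoint_pair K ip' H ip T S"
proof -
  interpret H: function_inner_product H ip by fact
  interpret K: function_inner_product K ip' by fact
  interpret ST: bounded_adjoint_pair H ip K ip' S T by fact
  show ?thesis
  proof
    show "ip f (T g) = ip' (S f) g" if "g \<in> K" "f \<in> H" for f g
      using H.ip_cnj[of "T g" f] K.ip_cnj[of g "S f"] that
      by (simp add: ST.S_mem ST.T_mem ST.adjoint)
  qed (simp_all add: ST.S_mem ST.T_mem ST.S_lin ST.T_lin ST.S_bounded ST.T_bounded)
qed

lemma bounded_adjoint_pair_compose: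
  assumes "bounded_adjoint_pair H1 ip1 H2 ip2 S T" "bounded_adjoint_pair H2 ip2 H3 ip3 S' T'"
  shows "bounded_adjoint_pair H1 ip1 H3 ip3 (\<lambda>f. S' (S f)) (\<lambda>g. T (T' g))"
proof -
  interpret A: bounded_adjoint_pair H1 ip1 H2 ip2 S T by fact
  interpret B: bounded_adjoint_pair H2 ip2 H3 ip3 S' T' by fact
  obtain C D where CD: "C \<ge> 0" "\<forall>f\<in>H1. Re (ip2 (S f) (S f)) \<le> C * Re (ip1 f f)"
     "D \<ge> 0" "\<forall>g\<in>H2. Re (ip1 (T g) (T g)) \<le> D * Re (ip2 g g)"
    using A.S_bounded A.T_bounded by auto
  obtain C' D' where CD': "C' \<ge> 0" "\<forall>f\<in>H2. Re (ip3 (S' f) (S' f)) \<le> C' * Re (ip2 f f)"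
     "D' \<ge> 0" "\<forall>g\<in>H3. Re (ip2 (T' g) (T' g)) \<le> D' * Re (ip3 g g)"
    using B.S_bounded B.T_bounded by auto
  have S: "Re (ip3 (S' (S f)) (S' (S f))) \<le> C' * C * Re (ip1 f f)" if "f \<in> H1" for f
  proof -
    have "Re (ip3 (S' (S f)) (S' (S f))) \<le> C' * Re (ip2 (S f) (S f))"
      using CD' that by (auto simp: A.S_mem)
    also have "\<dots> \<le> C' * (C * Re (ip1 f f))"
      using CD CD' that by (intro mult_left_mono) auto
    finally show ?thesis by (simp add: mult.assoc)
  qed
  have T: "Re (ip1 (T (T' g)) (T (T' g))) \<le> D * D' * Re (ip3 g g)" if "g \<in> H3" for g
  proof -
    have "Re (ip1 (T (T' g)) (T (T' g))) \<le> D * Re (ip2 (T' g) (T' g))"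
      using CD that by (auto simp: B.T_mem)
    also have "\<dots> \<le> D * (D' * Re (ip3 g g))"
      using CD CD' that by (intro mult_left_mono) auto
    finally show ?thesis by (simp add: mult.assoc)
  qed
  show ?thesis
  proof
    show "\<exists>C\<ge>0. \<forall>f\<in>H1. Re (ip3 (S' (S f)) (S' (S f))) \<le> C * Re (ip1 f f)"
      using S CD CD' by (intro exI[of _ "C' * C"]) auto
    show "\<exists>C\<ge>0. \<forall>g\<in>H3. Re (ip1 (T (T' g)) (T (T' g))) \<le> C * Re (ip3 g g)"
      using T CD CD' by (intro exI[of _ "D * D'"]) auto
  qed (simp_all add: A.S_mem A.T_mem A.S_lin A.T_lin A.adjoint B.S_mem B.T_mem B.S_lin B.T_lin B.adjoint)
qed

context function_inner_product
begin

lemma bounded_symmetric_zero: "bounded_symmetric H ip (\<lambda>f x. 0)"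
proof
  show "ip g (\<lambda>x. 0) = ip (\<lambda>x. 0) f" if "f \<in> H" "g \<in> H" for f g
    using ip_cnj[OF _ zero_mem, of f] that by (simp add: zero_mem ip_zero_right)
qed (auto simp: zero_mem ip_zero_right)

lemma bounded_symmetric_add:
  assumes "bounded_symmetric H ip S" "bounded_symmetric H ip T"
  shows "bounded_symmetric H ip (\<lambda>f x. S f x + T f x)"
proof -
  interpret S: bounded_adjoint_pair H ip H ip S S by fact
  interpret T: bounded_adjoint_pair H ip H ip T T by fact
  obtain C D where C: "C \<ge> 0" "\<forall>f\<in>H. sq (S f) \<le> C * sq f"
    and D: "D \<ge> 0" "\<forall>f\<in>H. sq (T f) \<le> D * sq f"
    using S.S_bounded T.S_bounded by auto
  have "sq (\<lambda>x. S f x + T f x) \<le> (2 * C + 2 * D) * sq f" if "f \<in> H" for f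
    using sq_add_le[OF S.S_mem[OF that] T.S_mem[OF that]] C(2)[rule_format, OF that]
      D(2)[rule_format, OF that]
    by (simp add: algebra_simps)
  then have bounded: "\<exists>C\<ge>0. \<forall>f\<in>H. sq (\<lambda>x. S f x + T f x) \<le> C * sq f"
    using C D by (intro exI[of _ "2 * C + 2 * D"]) auto
  show ?thesis
  proof
    show "ip g (\<lambda>x. S f x + T f x) = ip (\<lambda>x. S g x + T g x) f" if "f \<in> H" "g \<in> H" for f g
      using that by (simp add: ip_add_right ip_add_left S.S_mem T.S_mem S.adjoint T.adjoint)
    show "(\<lambda>x. S (\<lambda>x. a * f x + g x) x + T (\<lambda>x. a * f x + g x) x) =
        (\<lambda>x. a * (S f x + T f x) + (S g x + T g x))" if "f \<in> H" "g \<in> H" for a f g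
      using that by (simp only: S.S_lin T.S_lin) (simp add: algebra_simps)
  qed (simp_all add: bounded add_mem S.S_mem T.S_mem)
qed

lemma bounded_symmetric_converges_to:
  assumes "bounded_symmetric H ip T" and u: "\<And>k. u k \<in> H" and f: "f \<in> H"
    and "converges_to ip u f"
  shows "converges_to ip (\<lambda>k. T (u k)) (T f)"
proof -
  interpret T: bounded_adjoint_pair H ip H ip T T by fact
  obtain C where C: "C \<ge> 0" "\<And>f. f \<in> H \<Longrightarrow> sq (T f) \<le> C * sq f"
    using T.S_bounded by auto
  have diff: "T (\<lambda>x. u k x - f x) = (\<lambda>x. T (u k) x - T f x)" for k
    using T.S_lin[OF f u[of k], of "-1"] by simp
  have "(\<lambda>k. sq (\<lambda>x. u k x - f x)) \<longlonglongrightarrow> 0"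
    using assms by (simp add: converges_to_iff)
  then have lim: "(\<lambda>k. C * sq (\<lambda>x. u k x - f x)) \<longlonglongrightarrow> 0"
    by (rule tendsto_mult_right_zero)
  have "(\<lambda>k. sq (\<lambda>x. T (u k) x - T f x)) \<longlonglongrightarrow> 0"
  proof (rule tendsto_sandwich[OF _ _ tendsto_const lim])
    show "\<forall>\<^sub>F k in sequentially. sq (\<lambda>x. T (u k) x - T f x) \<le> C * sq (\<lambda>x. u k x - f x)"
      using C(2)[OF diff_mem[OF u f]] by (auto simp: diff)
    show "\<forall>\<^sub>F k in sequentially. 0 \<le> sq (\<lambda>x. T (u k) x - T f x)"
      using u f by (auto intro!: always_eventually ip_pos diff_mem T.S_mem)
  qed
  then show ?thesis
    using u f by (simp add: converges_to_iff T.S_mem)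
qed

text \<open>
  By continuity the closure of the restriction of \<open>T\<close> to \<open>D\<close> is the graph of \<open>T\<close> on all of \<open>H\<close>. If
  \<open>(g, h)\<close> belongs to the adjoint of that graph, then symmetry makes \<open>T g - h\<close> orthogonal to every
  vector of \<open>H\<close>, in particular to itself, so \<open>h = T g\<close>.
\<close>

theorem bounded_symmetric_essentially_self_adjoint:
  assumes sym: "bounded_symmetric H ip T" and D: "dense_subset H ip D"
    and D0: "(\<lambda>x. 0) \<in> D" and Dlin: "\<And>a f g. f \<in> D \<Longrightarrow> g \<in> D \<Longrightarrow> (\<lambda>x. a * f x + g x) \<in> D"
  shows "essentially_self_adjoint_on H ip D T"
proof -
  interpret T: bounded_adjoint_pair H ip H ip T T by fact
  have T0: "T (\<lambda>x. 0) = (\<lambda>x. 0)"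
    using T.S_lin[OF zero_mem zero_mem, of "-1"] by simp
  have DH: "D \<subseteq> H"
    using D unfolding dense_subset_def by auto
  have op: "densely_defined_operator H ip {(f, T f) | f. f \<in> E}"
    if "dense_subset H ip E" "(\<lambda>x. 0) \<in> E" "\<And>a f g. f \<in> E \<Longrightarrow> g \<in> E \<Longrightarrow> (\<lambda>x. a * f x + g x) \<in> E" for E
  proof -
    have "E \<subseteq> H"
      using that unfolding dense_subset_def by auto
    moreover have "Domain {(f, T f) | f. f \<in> E} = E"
      by auto
    ultimately show ?thesis
      unfolding densely_defined_operator_def using that
      by (auto simp: single_valued_def T.S_mem T.S_lin T0 subset_iff)
  qed
  have closure: "closure_graph H ip {(f, T f) | f. f \<in> D} = {(f, T f) | f. f \<in> H}"
  proof (intro set_eqI iffI; clarify)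
    fix f g assume "(f, g) \<in> closure_graph H ip {(f, T f) | f. f \<in> D}"
    then obtain u v where uv: "f \<in> H" "g \<in> H" "\<And>k. u k \<in> D" "\<And>k. v k = T (u k)"
      "converges_to ip u f" "converges_to ip v g"
      unfolding closure_graph_def by auto
    have uH: "u k \<in> H" for k
      using uv DH by auto
    have v: "v = (\<lambda>k. T (u k))"
      using uv by auto
    have "converges_to ip v (T f)"
      unfolding v by (rule bounded_symmetric_converges_to[OF sym uH uv(1,5)])
    then have "g = T f"
      using uv uH by (intro converges_to_unique[of v]) (simp_all add: T.S_mem)
    then show "\<exists>f'. (f, g) = (f', T f') \<and> f' \<in> H"
      using uv by auto
  next
    fix f assume f: "f \<in> H"
    then obtain u where u: "\<And>k. u k \<in> D" "converges_to ip u f"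
      using D unfolding dense_subset_def by blast
    have "converges_to ip (\<lambda>k. T (u k)) (T f)"
      using u(1) DH by (intro bounded_symmetric_converges_to[OF sym _ f u(2)]) auto
    moreover have "\<forall>k. (u k, T (u k)) \<in> {(f, T f) | f. f \<in> D}"
      using u(1) by blast
    ultimately have "\<exists>u v. (\<forall>k. (u k, v k) \<in> {(f, T f) | f. f \<in> D}) \<and>
        converges_to ip u f \<and> converges_to ip v (T f)"
      using u(2) by (intro exI[of _ u] exI[of _ "\<lambda>k. T (u k)"] conjI)
    then show "(f, T f) \<in> closure_graph H ip {(f, T f) | f. f \<in> D}"
      unfolding closure_graph_def mem_Collect_eq case_prod_conv
      by (intro conjI f T.S_mem[OF f])
  qed
  have adjoint: "adjoint_graph H ip {(f, T f) | f. f \<in> H} = {(f, T f) | f. f \<in> H}"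
  proof (intro set_eqI iffI; clarify)
    fix g h assume "(g, h) \<in> adjoint_graph H ip {(f, T f) | f. f \<in> H}"
    then have gh: "g \<in> H" "h \<in> H" "\<And>f. f \<in> H \<Longrightarrow> ip g (T f) = ip h f"
      unfolding adjoint_graph_def by auto
    let ?w = "\<lambda>x. T g x - h x"
    have w: "?w \<in> H"
      using gh by (intro diff_mem T.S_mem)
    have "ip ?w ?w = ip (T g) ?w - ip h ?w"
      using gh w by (simp add: ip_diff_left T.S_mem)
    also have "\<dots> = 0"
      using gh(3)[OF w] T.adjoint[OF w gh(1)] by simp
    finally have "?w = (\<lambda>x. 0)"
      using w by (intro ip_definite) auto
    then have "h = T g"
      by (simp add: fun_eq_iff)
    then show "\<exists>f. (g, h) = (f, T f) \<and> f \<in> H"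
      using gh by auto
  next
    fix f assume "f \<in> H"
    then show "(f, T f) \<in> adjoint_graph H ip {(f, T f) | f. f \<in> H}"
      unfolding adjoint_graph_def by (auto simp: T.S_mem T.adjoint)
  qed
  have "dense_subset H ip H"
    unfolding dense_subset_def using converges_to_const by (auto intro!: exI[of _ "\<lambda>k. f" for f])
  then have "densely_defined_operator H ip {(f, T f) | f. f \<in> H}"
    by (intro op zero_mem lin_mem)
  then have "self_adjoint H ip {(f, T f) | f. f \<in> H}"
    unfolding self_adjoint_def by (rule conjI[OF _ adjoint])
  moreover have "densely_defined_operator H ip {(f, T f) | f. f \<in> D}"
    by (intro op D D0 Dlin)
  ultimately show ?thesis
    unfolding essentially_self_adjoint_on_def closure by (intro conjI)
qed

end

section \<open>Summation lemmas\<close>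

lemma has_sum_finite_sum:
  fixes \<phi> :: "'a \<Rightarrow> 'b \<Rightarrow> 'c :: {comm_monoid_add, t2_space, topological_comm_monoid_add}"
  assumes "finite J" "\<And>j. j \<in> J \<Longrightarrow> \<phi> j summable_on A"
  shows "((\<lambda>x. \<Sum>j\<in>J. \<phi> j x) has_sum (\<Sum>j\<in>J. infsum (\<phi> j) A)) A"
  using assms by (induction rule: finite_induct) (auto intro!: has_sum_add has_sum_infsum)

lemma weighted_product_summable:
  fixes f g :: "'b \<Rightarrow> complex"
  assumes "(\<lambda>x. w x * (cmod (f x))\<^sup>2) summable_on A" "(\<lambda>x. w x * (cmod (g x))\<^sup>2) summable_on A"
    and "\<And>x. x \<in> A \<Longrightarrow> w x \<ge> 0"
  shows "(\<lambda>x. complex_of_real (w x) * cnj (f x) * g x) summable_on A"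
proof -
  have "(\<lambda>x. norm (complex_of_real (w x) * cnj (f x) * g x)) summable_on A"
  proof (rule summable_on_comparison_test)
    show "(\<lambda>x. w x * (cmod (f x))\<^sup>2 + w x * (cmod (g x))\<^sup>2) summable_on A"
      by (intro summable_on_add assms)
    fix x assume x: "x \<in> A"
    have "cmod (f x) * cmod (g x) \<le> (cmod (f x))\<^sup>2 + (cmod (g x))\<^sup>2"
      using sum_squares_bound[of "cmod (f x)" "cmod (g x)"]
        mult_nonneg_nonneg[of "cmod (f x)" "cmod (g x)"] by (simp add: mult.assoc del: mult_nonneg_nonneg)
    then have "w x * (cmod (f x) * cmod (g x)) \<le> w x * ((cmod (f x))\<^sup>2 + (cmod (g x))\<^sup>2)"
      using assms(3)[OF x] by (intro mult_left_mono)
    then show "norm (complex_of_real (w x) * cnj (f x) * g x)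
        \<le> w x * (cmod (f x))\<^sup>2 + w x * (cmod (g x))\<^sup>2"
      using assms(3)[OF x] by (simp add: norm_mult distrib_left mult.assoc)
  qed simp
  then show ?thesis
    by (rule abs_summable_summable)
qed

section \<open>Moving a vertex to the last position\<close>

text \<open>
  The cycle on \<open>{0, \<dots>, N}\<close> for which \<open>permute_list\<close> takes entry \<open>j\<close> out of a list of length
  \<open>N + 1\<close> and appends it at the end.
\<close>

definition move_to_end :: "nat \<Rightarrow> nat \<Rightarrow> nat \<Rightarrow> nat" where
  "move_to_end N j k = (if k < j \<or> k > N then k else if k = N then j else k + 1)"

lemma move_to_end_permutes_sign:
  assumes "j \<le> N"
  shows "move_to_end N j permutes {..<N + 1} \<and> sign (move_to_end N j) = (-1) ^ (N - j)"
  using assms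
proof (induction j rule: inc_induct)
  case base
  have "move_to_end N N = id"
    by (auto simp: fun_eq_iff move_to_end_def)
  then show ?case
    using permutes_id by (metis diff_self_eq_0 power_0 sign_id)
next
  case (step j)
  \<comment> \<open>Built from adjacent transpositions, starting at the identity for \<open>j = N\<close>; each step flips the sign.\<close>
  have eq: "move_to_end N j = Transposition.transpose j (Suc j) \<circ> move_to_end N (Suc j)"
    using step.hyps by (auto simp: fun_eq_iff Transposition.transpose_def move_to_end_def)
  have p: "Transposition.transpose j (Suc j) permutes {..<N + 1}"
    using step.hyps by (intro permutes_swap_id) auto
  have "sign (move_to_end N j) = - sign (move_to_end N (Suc j))"
    unfolding eq using step.IH p
    by (subst sign_compose) (auto simp: sign_swap_id intro: permutes_imp_permutation)
  moreover have "N - j = Suc (N - Suc j)"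
    using step.hyps by auto
  moreover have "move_to_end N j permutes {..<N + 1}"
    unfolding eq using step.IH p by (intro permutes_compose) auto
  ultimately show ?case
    using step.IH by simp
qed

lemmas move_to_end_permutes = move_to_end_permutes_sign[THEN conjunct1]
lemmas sign_move_to_end = move_to_end_permutes_sign[THEN conjunct2]

lemma permute_list_move_to_end:
  assumes "length xs = N + 1" "j \<le> N"
  shows "permute_list (move_to_end N j) xs = delete_nth j xs @ [xs ! j]"
  using assms
  by (intro nth_equalityI)
     (auto simp: permute_list_def delete_nth_def nth_append min_def move_to_end_def)

lemma length_delete_nth: "j < length xs \<Longrightarrow> length (delete_nth j xs) = length xs - 1"
  by (simp add: delete_nth_def min_def)

lemma permute_list_snoc:
  assumes "p permutes {..<length ys}"
  shows "permute_list p (ys @ [y]) = permute_list p ys @ [y]"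
  using permutes_in_image[OF assms] permutes_not_in[OF assms, of "length ys"]
  by (intro nth_equalityI) (auto simp: permute_list_def nth_append less_Suc_eq)

text \<open>
  The vertices left after deleting entry \<open>j\<close> of a permuted list are those left after deleting entry
  \<open>p j\<close> of the original, in the order given by the permutation \<open>r\<close>. The sign of \<open>r\<close> is exactly what makes the
  alternating sum of faces alternating. It is computed by letting both deletions be cycles to the
  last position: \<open>r\<close> is \<open>p\<close> conjugated by these cycles and fixes that position.
\<close>

lemma delete_nth_permute_list:
  assumes p: "p permutes {..<N + 1}" and j: "j \<le> N"
  obtains r where "r permutes {..<N}" "sign r = sign p * (-1) ^ j * (-1) ^ p j"
    "\<And>xs :: 'a list. length xs = N + 1 \<Longrightarrow>
       delete_nth j (permute_list p xs) = permute_list r (delete_nth (p j) xs)"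
proof
  let ?c = "move_to_end N j" and ?d = "move_to_end N (p j)"
  define r where "r = inv ?d \<circ> (p \<circ> ?c)"
  have pj: "p j \<le> N"
    using permutes_in_image[OF p, of j] j by auto
  have c: "?c permutes {..<N + 1}" and d: "?d permutes {..<N + 1}"
    using j pj move_to_end_permutes by auto
  have r: "r permutes {..<N + 1}"
    unfolding r_def using p c d by (intro permutes_compose permutes_inv)
  have "r N = N"
    using permutes_inverses(2)[OF d, of N] j pj by (simp add: r_def move_to_end_def)
  then show rN: "r permutes {..<N}"
    using r by (intro permutes_superset[OF r]) (auto simp: less_Suc_eq)
  have perm: "permutation p" "permutation ?c" "permutation ?d" "permutation (inv ?d)"
    using p c d permutes_inv[OF d] by (auto intro: permutes_imp_permutation[rotated])
  have "sign r = (-1) ^ (N - p j) * (sign p * (-1) ^ (N - j))"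
    unfolding r_def using perm j pj
    by (simp add: sign_compose permutation_compose sign_inverse sign_move_to_end)
  also have "\<dots> = sign p * ((-1) ^ (N - j) * (-1) ^ (N - p j))"
    by simp
  also have "(-1) ^ (N - j) * (-1) ^ (N - p j) = ((-1) ^ j * (-1) ^ p j :: int)"
    using j pj by (simp add: minus_one_power_iff)
  finally show "sign r = sign p * (-1) ^ j * (-1) ^ p j"
    by (simp add: mult.assoc)
  fix xs :: "'a list" assume xs: "length xs = N + 1"
  have "delete_nth j (permute_list p xs) @ [permute_list p xs ! j] = permute_list (p \<circ> ?c) xs"
    using xs j c by (simp add: permute_list_move_to_end[symmetric] permute_list_compose)
  also have "p \<circ> ?c = ?d \<circ> r"
    using permutes_inv_o(1)[OF d] by (simp add: r_def o_assoc)
  also have "permute_list (?d \<circ> r) xs = permute_list r (delete_nth (p j) xs @ [xs ! p j])"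
    using xs pj r by (simp add: permute_list_compose permute_list_move_to_end)
  also have "\<dots> = permute_list r (delete_nth (p j) xs) @ [xs ! p j]"
    using xs pj rN by (intro permute_list_snoc) (simp add: length_delete_nth)
  finally show "delete_nth j (permute_list p xs) = permute_list r (delete_nth (p j) xs)"
    by simp
qed

section \<open>Simplices and their faces\<close>

locale locally_finite_weighted_complex = weighted_oriented_complex V n m Pos
  for V :: "'v set" and n m Pos +
  assumes locally_finite: "locally_finite_complex V m"
begin

abbreviation \<Sigma> :: "nat \<Rightarrow> 'v list set" where
  "\<Sigma> i \<equiv> simplices V m i"

lemma adjacent_sym: "adjacent V m x y \<longleftrightarrow> adjacent V m y x"
proof -
  have "m 1 [y, x] = m 1 [x, y]" if "x \<in> V" "y \<in> V" for x y
    using weight_perm[of 1 "[x, y]" "Transposition.transpose 0 1"] n_ge_2 that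
    by (auto simp: permute_list_def permutes_swap_id)
  then show ?thesis
    by (auto simp: adjacent_def)
qed

lemma simplices_iff:
  "xs \<in> \<Sigma> i \<longleftrightarrow> length xs = i + 1 \<and> set xs \<subseteq> V \<and> sorted_wrt (adjacent V m) xs"
proof -
  have "(\<forall>j<length xs. \<forall>k<length xs. j \<noteq> k \<longrightarrow> adjacent V m (xs ! j) (xs ! k)) \<longleftrightarrow>
      sorted_wrt (adjacent V m) xs"
    (is "?lhs \<longleftrightarrow> ?rhs")
  proof
    assume ?rhs
    then have "adjacent V m (xs ! j) (xs ! k)" if "j < length xs" "k < length xs" "j \<noteq> k" for j k
      using that adjacent_sym[of "xs ! j" "xs ! k"]
      by (cases j k rule: linorder_cases) (auto simp: sorted_wrt_iff_nth_less)
    then show ?lhs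
      by blast
  qed (auto simp: sorted_wrt_iff_nth_less)
  then show ?thesis
    by (auto simp: simplices_def)
qed

lemma snoc_simplices_iff:
  "ys @ [y] \<in> \<Sigma> (i + 1) \<longleftrightarrow> ys \<in> \<Sigma> i \<and> y \<in> common_neighbours V m ys"
  by (auto simp: simplices_iff sorted_wrt_append common_neighbours_def)

lemma permute_simplices:
  assumes "xs \<in> \<Sigma> i" "p permutes {..<i + 1}"
  shows "permute_list p xs \<in> \<Sigma> i"
proof -
  have "length xs = i + 1"
    using assms(1) by (simp add: simplices_def)
  then show ?thesis
    using assms permutes_in_image[OF assms(2)] permutes_inj[OF assms(2)]
    by (auto simp: simplices_def permute_list_nth inj_eq)
qed

lemma bij_betw_permute_simplices:
  assumes "p permutes {..<i + 1}"
  shows "bij_betw (permute_list p) (\<Sigma> i) (\<Sigma> i)"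
proof (rule bij_betw_byWitness[where f' = "permute_list (inv p)"])
  have len: "length xs = i + 1" if "xs \<in> \<Sigma> i" for xs
    using that by (simp add: simplices_def)
  show "\<forall>xs\<in>\<Sigma> i. permute_list (inv p) (permute_list p xs) = xs"
    using assms len permutes_inv[OF assms]
    by (auto simp: permute_list_compose[symmetric] permutes_inv_o)
  show "\<forall>xs\<in>\<Sigma> i. permute_list p (permute_list (inv p) xs) = xs"
    using assms len by (auto simp: permute_list_compose[symmetric] permutes_inv_o)
qed (auto intro: permute_simplices assms permutes_inv)

lemma finite_common_neighbours:
  assumes "ys \<in> \<Sigma> i"
  shows "finite (common_neighbours V m ys)"
proof -
  have "hd ys \<in> set ys" "hd ys \<in> V"
    using assms by (cases ys; auto simp: simplices_def)+
  then have "common_neighbours V m ys \<subseteq> {y. adjacent V m (hd ys) y}"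
    by (auto simp: common_neighbours_def)
  then show ?thesis
    using locally_finite \<open>hd ys \<in> V\<close> unfolding locally_finite_complex_def
    by (auto intro: finite_subset)
qed

lemma bij_betw_snoc:
  "bij_betw (\<lambda>(ys, y). ys @ [y]) (SIGMA ys:\<Sigma> i. common_neighbours V m ys) (\<Sigma> (i + 1))"
proof (rule bij_betw_byWitness[where f' = "\<lambda>xs. (butlast xs, last xs)"])
  have snoc: "xs = butlast xs @ [last xs]" if "xs \<in> \<Sigma> (i + 1)" for xs
    using that by (cases xs rule: rev_cases) (auto simp: simplices_def)
  then show "\<forall>xs\<in>\<Sigma> (i + 1). (case (butlast xs, last xs) of (ys, y) \<Rightarrow> ys @ [y]) = xs"
    by auto
  show "(\<lambda>xs. (butlast xs, last xs)) ` \<Sigma> (i + 1) \<subseteq> (SIGMA ys:\<Sigma> i. common_neighbours V m ys)"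
    using snoc snoc_simplices_iff by (auto, metis+)
  show "(\<lambda>(ys, y). ys @ [y]) ` (SIGMA ys:\<Sigma> i. common_neighbours V m ys) \<subseteq> \<Sigma> (i + 1)"
    using snoc_simplices_iff by auto
qed auto

text \<open>
  For nonnegative functions, summability of the fibre sums suffices; this gives the existence of the
  sums over \<open>(i + 1)\<close>-simplices to which \<open>infsum_snoc\<close> is applied.
\<close>

lemma summable_on_snoc:
  fixes \<phi> :: "'v list \<Rightarrow> real"
  assumes "(\<lambda>ys. \<Sum>y\<in>common_neighbours V m ys. \<phi> (ys @ [y])) summable_on \<Sigma> i"
    and "\<And>xs. xs \<in> \<Sigma> (i + 1) \<Longrightarrow> \<phi> xs \<ge> 0"
  shows "\<phi> summable_on \<Sigma> (i + 1)"
proof -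
  have "(\<lambda>(ys, y). \<phi> (ys @ [y])) summable_on (SIGMA ys:\<Sigma> i. common_neighbours V m ys)"
  proof (rule summable_on_SigmaI[OF _ assms(1)])
    show "((\<lambda>y. case (ys, y) of (ys, y) \<Rightarrow> \<phi> (ys @ [y])) has_sum
        (\<Sum>y\<in>common_neighbours V m ys. \<phi> (ys @ [y]))) (common_neighbours V m ys)"
      if "ys \<in> \<Sigma> i" for ys
      using finite_common_neighbours[OF that] by (simp add: has_sum_finite)
    show "0 \<le> (case (ys, y) of (ys, y) \<Rightarrow> \<phi> (ys @ [y]))"
      if "ys \<in> \<Sigma> i" "y \<in> common_neighbours V m ys" for ys y
      using that assms(2) snoc_simplices_iff by simp
  qed
  then show ?thesis
    using summable_on_reindex_bij_betw[OF bij_betw_snoc, of \<phi> i]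
    by (simp add: case_prod_unfold)
qed

lemma
  fixes \<phi> :: "'v list \<Rightarrow> 'b :: banach"
  assumes "\<phi> summable_on \<Sigma> (i + 1)"
  shows infsum_snoc:
      "infsum \<phi> (\<Sigma> (i + 1)) = (\<Sum>\<^sub>\<infinity>ys\<in>\<Sigma> i. \<Sum>y\<in>common_neighbours V m ys. \<phi> (ys @ [y]))"
    and summable_on_fibres:
      "(\<lambda>ys. \<Sum>y\<in>common_neighbours V m ys. \<phi> (ys @ [y])) summable_on \<Sigma> i"
proof -
  let ?C = "common_neighbours V m"
  have summable: "(\<lambda>(ys, y). \<phi> (ys @ [y])) summable_on (SIGMA ys:\<Sigma> i. ?C ys)"
    using assms summable_on_reindex_bij_betw[OF bij_betw_snoc, of \<phi> i]
    by (simp add: case_prod_unfold)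
  have fin: "(\<Sum>\<^sub>\<infinity>y\<in>?C ys. \<phi> (ys @ [y])) = (\<Sum>y\<in>?C ys. \<phi> (ys @ [y]))" if "ys \<in> \<Sigma> i" for ys
    using finite_common_neighbours[OF that] by (rule infsum_finite)
  have "infsum \<phi> (\<Sigma> (i + 1)) = infsum (\<lambda>(ys, y). \<phi> (ys @ [y])) (SIGMA ys:\<Sigma> i. ?C ys)"
    using infsum_reindex_bij_betw[OF bij_betw_snoc, of \<phi> i] by (simp add: case_prod_unfold)
  also have "\<dots> = (\<Sum>\<^sub>\<infinity>ys\<in>\<Sigma> i. \<Sum>\<^sub>\<infinity>y\<in>?C ys. \<phi> (ys @ [y]))"
    using infsum_Sigma'_banach[OF summable] by simp
  also have "\<dots> = (\<Sum>\<^sub>\<infinity>ys\<in>\<Sigma> i. \<Sum>y\<in>?C ys. \<phi> (ys @ [y]))"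
    by (intro infsum_cong fin)
  finally show "infsum \<phi> (\<Sigma> (i + 1)) = (\<Sum>\<^sub>\<infinity>ys\<in>\<Sigma> i. \<Sum>y\<in>?C ys. \<phi> (ys @ [y]))" .
  have "(\<lambda>ys. \<Sum>\<^sub>\<infinity>y\<in>?C ys. \<phi> (ys @ [y])) summable_on \<Sigma> i"
    using summable_on_Sigma_banach[OF summable] by simp
  then show "(\<lambda>ys. \<Sum>y\<in>?C ys. \<phi> (ys @ [y])) summable_on \<Sigma> i"
    using summable_on_cong[of "\<Sigma> i", OF fin] by simp
qed

section \<open>The Hilbert space of square-summable cochains\<close>

lemma weight_pos: "i \<le> n - 1 \<Longrightarrow> xs \<in> \<Sigma> i \<Longrightarrow> m i xs > 0"
  using weight_pos_iff[of i xs] by (auto simp: simplices_def)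

lemma weight_ge_0: "i \<le> n - 1 \<Longrightarrow> xs \<in> \<Sigma> i \<Longrightarrow> m i xs \<ge> 0"
  using weight_pos less_imp_le by blast

lemma weight_permute:
  "i \<le> n - 1 \<Longrightarrow> xs \<in> \<Sigma> i \<Longrightarrow> p permutes {..<i + 1} \<Longrightarrow> m i (permute_list p xs) = m i xs"
  using weight_perm[of i xs] by (auto simp: simplices_def)

lemma alternating_outside: "alternating V m i f \<Longrightarrow> xs \<notin> \<Sigma> i \<Longrightarrow> f xs = 0"
  by (simp add: alternating_def)

lemma alternating_permute:
  "alternating V m i f \<Longrightarrow> xs \<in> \<Sigma> i \<Longrightarrow> p permutes {..<i + 1} \<Longrightarrow>
    f (permute_list p xs) = of_int (sign p) * f xs"
  by (simp add: alternating_def)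

lemma alternating_zero: "alternating V m i (\<lambda>xs. 0)"
  by (simp add: alternating_def)

lemma alternating_lin:
  "alternating V m i f \<Longrightarrow> alternating V m i g \<Longrightarrow> alternating V m i (\<lambda>xs. a * f xs + g xs)"
  by (simp add: alternating_def algebra_simps)

definition sqnorm :: "nat \<Rightarrow> 'v cochain \<Rightarrow> real" where
  "sqnorm i f = (\<Sum>\<^sub>\<infinity>xs\<in>\<Sigma> i. m i xs * (cmod (f xs))\<^sup>2)"

lemma ell2_alternating: "f \<in> ell2 V m i \<Longrightarrow> alternating V m i f"
  by (simp add: ell2_def)

lemma ell2_summable: "f \<in> ell2 V m i \<Longrightarrow> (\<lambda>xs. m i xs * (cmod (f xs))\<^sup>2) summable_on \<Sigma> i"
  by (simp add: ell2_def)

lemma sqnorm_nonneg: "i \<le> n - 1 \<Longrightarrow> sqnorm i f \<ge> 0"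
  unfolding sqnorm_def by (intro infsum_nonneg mult_nonneg_nonneg weight_ge_0 zero_le_power2)

lemma ell2_product_summable:
  assumes "i \<le> n - 1" "f \<in> ell2 V m i" "g \<in> ell2 V m i"
  shows "(\<lambda>xs. complex_of_real (m i xs) * cnj (f xs) * g xs) summable_on \<Sigma> i"
  using assms by (intro weighted_product_summable ell2_summable weight_ge_0)

lemma ell2_inner_self:
  assumes "f \<in> ell2 V m i"
  shows "Re (ell2_inner V m i f f) = sqnorm i f / fact (i + 1)"
proof -
  have "((\<lambda>xs. complex_of_real (m i xs * (cmod (f xs))\<^sup>2)) has_sum complex_of_real (sqnorm i f)) (\<Sigma> i)"
    unfolding sqnorm_def by (intro has_sum_of_real has_sum_infsum ell2_summable assms)
  then have "(\<Sum>\<^sub>\<infinity>xs\<in>\<Sigma> i. complex_of_real (m i xs * (cmod (f xs))\<^sup>2)) = complex_of_real (sqnorm i f)"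
    by (rule infsumI)
  moreover have "complex_of_real (m i xs * (cmod (f xs))\<^sup>2) = complex_of_real (m i xs) * cnj (f xs) * f xs" for xs
    using complex_norm_square[of "f xs"] by (simp add: mult_ac)
  ultimately have "(\<Sum>\<^sub>\<infinity>xs\<in>\<Sigma> i. complex_of_real (m i xs) * cnj (f xs) * f xs) = complex_of_real (sqnorm i f)"
    by (simp only:)
  then have "ell2_inner V m i f f = complex_of_real (1 / fact (i + 1) * sqnorm i f)"
    unfolding ell2_inner_def by simp
  then show ?thesis
    by (simp only: Re_complex_of_real) simp
qed

lemma ell2_inner_product:
  assumes i: "i \<le> n - 1"
  shows "function_inner_product (ell2 V m i) (ell2_inner V m i)"
proof
  show "(\<lambda>xs. 0) \<in> ell2 V m i"
    by (simp add: ell2_def alternating_zero)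
  show "(\<lambda>xs. a * f xs + g xs) \<in> ell2 V m i" if f: "f \<in> ell2 V m i" and g: "g \<in> ell2 V m i" for a f g
  proof -
    have "(\<lambda>xs. m i xs * (cmod (a * f xs + g xs))\<^sup>2) summable_on \<Sigma> i"
    proof (rule summable_on_comparison_test)
      show "(\<lambda>xs. 2 * (cmod a)\<^sup>2 * (m i xs * (cmod (f xs))\<^sup>2) + 2 * (m i xs * (cmod (g xs))\<^sup>2)) summable_on \<Sigma> i"
        using f g by (intro summable_on_add summable_on_cmult_right ell2_summable)
      fix xs assume "xs \<in> \<Sigma> i"
      then have w: "m i xs \<ge> 0"
        by (rule weight_ge_0[OF i])
      then show "0 \<le> m i xs * (cmod (a * f xs + g xs))\<^sup>2"
        by simp
      have "(cmod (a * f xs + g xs))\<^sup>2 \<le> (cmod a * cmod (f xs) + cmod (g xs))\<^sup>2"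
        by (intro power_mono) (metis norm_mult norm_triangle_ineq, simp)
      also have "\<dots> \<le> 2 * (cmod a * cmod (f xs))\<^sup>2 + 2 * (cmod (g xs))\<^sup>2"
        using sum_squares_bound[of "cmod a * cmod (f xs)" "cmod (g xs)"] by (simp add: power2_sum)
      finally have "m i xs * (cmod (a * f xs + g xs))\<^sup>2
          \<le> m i xs * (2 * (cmod a * cmod (f xs))\<^sup>2 + 2 * (cmod (g xs))\<^sup>2)"
        using w by (rule mult_left_mono)
      then show "m i xs * (cmod (a * f xs + g xs))\<^sup>2
          \<le> 2 * (cmod a)\<^sup>2 * (m i xs * (cmod (f xs))\<^sup>2) + 2 * (m i xs * (cmod (g xs))\<^sup>2)"
        by (simp add: algebra_simps power_mult_distrib)
    qed
    then show ?thesis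
      using f g by (simp add: ell2_def alternating_lin)
  qed
  show "ell2_inner V m i h (\<lambda>xs. a * f xs + g xs) = a * ell2_inner V m i h f + ell2_inner V m i h g"
    if f: "f \<in> ell2 V m i" and g: "g \<in> ell2 V m i" and h: "h \<in> ell2 V m i" for a f g h
  proof -
    have "(\<Sum>\<^sub>\<infinity>xs\<in>\<Sigma> i. complex_of_real (m i xs) * cnj (h xs) * (a * f xs + g xs)) =
       (\<Sum>\<^sub>\<infinity>xs\<in>\<Sigma> i. a * (complex_of_real (m i xs) * cnj (h xs) * f xs) +
          complex_of_real (m i xs) * cnj (h xs) * g xs)"
      by (simp add: algebra_simps)
    also have "\<dots> = a * (\<Sum>\<^sub>\<infinity>xs\<in>\<Sigma> i. complex_of_real (m i xs) * cnj (h xs) * f xs) +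
          (\<Sum>\<^sub>\<infinity>xs\<in>\<Sigma> i. complex_of_real (m i xs) * cnj (h xs) * g xs)"
      using ell2_product_summable[OF i h f] ell2_product_summable[OF i h g]
      by (subst infsum_add) (auto intro: summable_on_cmult_right simp: infsum_cmult_right)
    finally show ?thesis
      by (simp add: ell2_inner_def algebra_simps)
  qed
  show "ell2_inner V m i g f = cnj (ell2_inner V m i f g)" for f g
    by (simp add: ell2_inner_def mult_ac flip: infsum_cnj)
  show "0 \<le> Re (ell2_inner V m i f f)" if "f \<in> ell2 V m i" for f
    using that by (simp add: ell2_inner_self sqnorm_nonneg[OF i])
  show "f = (\<lambda>xs. 0)" if f: "f \<in> ell2 V m i" and "Re (ell2_inner V m i f f) = 0" for f
  proof
    fix xs
    show "f xs = 0"
    proof (cases "xs \<in> \<Sigma> i")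
      case True
      have "sqnorm i f \<le> 0"
        using that by (simp add: ell2_inner_self)
      then have "m i xs * (cmod (f xs))\<^sup>2 = 0"
        unfolding sqnorm_def
        using ell2_summable[OF f] weight_ge_0[OF i] True
        by (intro nonneg_infsum_le_0D[where A = "\<Sigma> i"]) auto
      then show ?thesis
        using weight_pos[OF i True] by simp
    qed (rule alternating_outside[OF ell2_alternating[OF f]])
  qed
qed

lemma Cc_lin:
  assumes "f \<in> Cc V m i" "g \<in> Cc V m i"
  shows "(\<lambda>xs. a * f xs + g xs) \<in> Cc V m i"
proof -
  have "{xs. a * f xs + g xs \<noteq> 0} \<subseteq> {xs. f xs \<noteq> 0} \<union> {xs. g xs \<noteq> 0}"
    by auto
  then show ?thesis
    using assms finite_subset by (auto simp: Cc_def alternating_lin)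
qed

lemma Cc_subset_ell2: "Cc V m i \<subseteq> ell2 V m i"
proof
  fix f assume f: "f \<in> Cc V m i"
  have "(\<lambda>xs. m i xs * (cmod (f xs))\<^sup>2) summable_on {xs \<in> \<Sigma> i. f xs \<noteq> 0}"
    using f by (intro summable_on_finite) (auto simp: Cc_def intro: finite_subset[rotated])
  then have "(\<lambda>xs. m i xs * (cmod (f xs))\<^sup>2) summable_on \<Sigma> i"
    by (rule summable_on_cong_neutral[THEN iffD1, rotated 3]) auto
  with f show "f \<in> ell2 V m i"
    by (simp add: Cc_def ell2_def)
qed

text \<open>
  The restriction of \<open>f\<close> to simplices inside \<open>O\<^sub>k\<close> is finitely supported, since there are finitely
  many lists of given length over a finite set. The squared distance to \<open>f\<close> is the remainder of a
  convergent sum, because these finite sets of simplices eventually contain every finite set of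
  simplices.
\<close>

lemma Cc_dense:
  assumes i: "i \<le> n - 1" and fin: "\<And>k. finite (Ok k)" and inc: "incseq Ok" and un: "(\<Union>k. Ok k) = V"
  shows "dense_subset (ell2 V m i) (ell2_inner V m i) (Cc V m i)"
  unfolding dense_subset_def
proof (intro conjI Cc_subset_ell2 ballI)
  interpret function_inner_product "ell2 V m i" "ell2_inner V m i"
    by (rule ell2_inner_product[OF i])
  fix f assume f: "f \<in> ell2 V m i"
  define A where "A k = {xs \<in> \<Sigma> i. set xs \<subseteq> Ok k}" for k
  define u where "u k = (\<lambda>xs. if set xs \<subseteq> Ok k then f xs else 0)" for k
  have finA: "finite (A k)" for k
  proof (rule finite_subset)
    show "A k \<subseteq> {xs. set xs \<subseteq> Ok k \<and> length xs = i + 1}"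
      by (auto simp: A_def simplices_def)
  qed (rule finite_lists_length_eq[OF fin])
  have u: "u k \<in> Cc V m i" for k
  proof -
    have "alternating V m i (u k)"
      using ell2_alternating[OF f] by (auto simp: u_def alternating_def simplices_def)
    moreover have "{xs. u k xs \<noteq> 0} \<subseteq> A k"
      using alternating_outside[OF ell2_alternating[OF f]] by (auto simp: u_def A_def)
    ultimately show ?thesis
      using finA finite_subset by (auto simp: Cc_def)
  qed
  let ?\<phi> = "\<lambda>xs. m i xs * (cmod (f xs))\<^sup>2"
  have "(?\<phi> has_sum sqnorm i f) (\<Sigma> i)"
    unfolding sqnorm_def by (rule has_sum_infsum[OF ell2_summable[OF f]])
  moreover have "filterlim A (finite_subsets_at_top (\<Sigma> i)) sequentially"
    unfolding filterlim_finite_subsets_at_top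
  proof (intro allI impI)
    fix F assume F: "finite F \<and> F \<subseteq> \<Sigma> i"
    have "\<forall>\<^sub>F k in sequentially. x \<in> Ok k" if "x \<in> V" for x
    proof -
      from that un obtain k0 where "x \<in> Ok k0"
        by auto
      then show ?thesis
        using incseqD[OF inc] by (auto intro!: eventually_sequentiallyI[of k0])
    qed
    then have "\<forall>\<^sub>F k in sequentially. \<forall>x\<in>(\<Union>xs\<in>F. set xs). x \<in> Ok k"
      using F by (intro eventually_ball_finite) (auto simp: simplices_def)
    then show "\<forall>\<^sub>F k in sequentially. finite (A k) \<and> F \<subseteq> A k \<and> A k \<subseteq> \<Sigma> i"
      by eventually_elim (use F finA in \<open>auto simp: A_def\<close>)
  qed
  ultimately have "(\<lambda>k. sum ?\<phi> (A k)) \<longlonglongrightarrow> sqnorm i f"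
    unfolding has_sum_def by (rule filterlim_compose)
  then have "(\<lambda>k. (sqnorm i f - sum ?\<phi> (A k)) / fact (i + 1)) \<longlonglongrightarrow> (sqnorm i f - sqnorm i f) / fact (i + 1)"
    by (intro tendsto_intros) auto
  moreover have "sqnorm i (\<lambda>xs. u k xs - f xs) = sqnorm i f - sum ?\<phi> (A k)" for k
  proof -
    have "sqnorm i (\<lambda>xs. u k xs - f xs) = infsum ?\<phi> (\<Sigma> i - A k)"
      unfolding sqnorm_def by (rule infsum_cong_neutral) (auto simp: u_def A_def)
    also have "\<dots> = infsum ?\<phi> (\<Sigma> i) - infsum ?\<phi> (A k)"
      using f finA by (intro infsum_Diff ell2_summable summable_on_finite) (auto simp: A_def)
    finally show ?thesis
      using finA by (simp add: sqnorm_def)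
  qed
  moreover have uH: "u k \<in> ell2 V m i" for k
    using u Cc_subset_ell2 by blast
  then have "Re (ell2_inner V m i (\<lambda>xs. u k xs - f xs) (\<lambda>xs. u k xs - f xs))
      = sqnorm i (\<lambda>xs. u k xs - f xs) / fact (i + 1)" for k
    by (intro ell2_inner_self diff_mem f)
  ultimately have "converges_to (ell2_inner V m i) u f"
    by (subst converges_to_iff[OF uH f]) (simp only: diff_self div_0)
  with u show "\<exists>u. (\<forall>k. u k \<in> Cc V m i) \<and> converges_to (ell2_inner V m i) u f"
    by blast
qed

section \<open>Coboundary and codifferential as bounded mutually adjoint operators\<close>


lemma codiff_eq:
  "ys \<in> \<Sigma> i \<Longrightarrow> codiff V m (i + 1) g ys = (-1) ^ (i + 1) / complex_of_real (m i ys) *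
    (\<Sum>y\<in>common_neighbours V m ys. complex_of_real (m (i + 1) (ys @ [y])) * g (ys @ [y]))"
  by (simp add: codiff_def)

lemma common_neighbours_permute:
  "p permutes {..<length ys} \<Longrightarrow> common_neighbours V m (permute_list p ys) = common_neighbours V m ys"
  by (simp add: common_neighbours_def)

lemma codiff_alternating:
  assumes i: "i + 1 \<le> n - 1" and g: "alternating V m (i + 1) g"
  shows "alternating V m i (codiff V m (i + 1) g)"
  unfolding alternating_def
proof (intro conjI allI impI)
  fix ys assume "ys \<notin> \<Sigma> i"
  then show "codiff V m (i + 1) g ys = 0"
    by (simp add: codiff_def)
next
  fix ys p assume ys: "ys \<in> \<Sigma> i" and p: "p permutes {..<i + 1}"
  have len: "length ys = i + 1"
    using ys by (simp add: simplices_def)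
  have p': "p permutes {..<i + 1 + 1}"
    using p by (rule permutes_subset) auto
  let ?C = "common_neighbours V m"
  have "complex_of_real (m (i + 1) (permute_list p ys @ [y])) * g (permute_list p ys @ [y]) =
      of_int (sign p) * (complex_of_real (m (i + 1) (ys @ [y])) * g (ys @ [y]))" if "y \<in> ?C ys" for y
  proof -
    have "ys @ [y] \<in> \<Sigma> (i + 1)"
      using ys that snoc_simplices_iff by simp
    moreover have "permute_list p ys @ [y] = permute_list p (ys @ [y])"
      using p len by (simp add: permute_list_snoc)
    ultimately show ?thesis
      using weight_permute[OF i _ p'] alternating_permute[OF g _ p'] by simp
  qed
  moreover have "?C (permute_list p ys) = ?C ys"
    using p len by (simp add: common_neighbours_permute)
  moreover have "m i (permute_list p ys) = m i ys"
    using i ys p by (intro weight_permute) auto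
  ultimately show "codiff V m (i + 1) g (permute_list p ys) = of_int (sign p) * codiff V m (i + 1) g ys"
    using ys permute_simplices[OF ys p]
    by (simp add: codiff_eq sum_distrib_left[symmetric] del: One_nat_def add_Suc_right)
qed

lemma delete_nth_simplices:
  assumes "xs \<in> \<Sigma> (i + 1)" "j \<le> i + 1"
  shows "delete_nth j xs \<in> \<Sigma> i"
proof -
  have "permute_list (move_to_end (i + 1) j) xs \<in> \<Sigma> (i + 1)"
    using assms by (intro permute_simplices move_to_end_permutes)
  moreover have "permute_list (move_to_end (i + 1) j) xs = delete_nth j xs @ [xs ! j]"
    using assms by (intro permute_list_move_to_end) (simp_all add: simplices_def)
  ultimately show ?thesis
    using snoc_simplices_iff by simp
qed

text \<open>
  The permutation \<open>p\<close> sends the term of index \<open>j\<close> to the one of index \<open>p j\<close>. The sign of the permutation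
  induced on the remaining vertices cancels the difference between \<open>(-1)\<^sup>j\<close> and \<open>(-1)\<close> to the
  power \<open>p j\<close> up to the sign of \<open>p\<close>.
\<close>

lemma coboundary_alternating:
  assumes f: "alternating V m i f"
  shows "alternating V m (i + 1) (coboundary V m i f)"
  unfolding alternating_def
proof (intro conjI allI impI)
  fix xs assume "xs \<notin> \<Sigma> (i + 1)"
  then show "coboundary V m i f xs = 0"
    by (simp add: coboundary_def)
next
  fix xs p assume xs: "xs \<in> \<Sigma> (i + 1)" and p: "p permutes {..<i + 1 + 1}"
  have len: "length xs = i + 1 + 1"
    using xs by (simp add: simplices_def)
  have pj: "p j \<le> i + 1" if "j \<le> i + 1" for j
    using permutes_in_image[OF p, of j] that by auto
  have face_sign: "(-1) ^ j * f (delete_nth j (permute_list p xs)) =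
      of_int (sign p) * ((-1) ^ p j * f (delete_nth (p j) xs))" if j: "j \<le> i + 1" for j
  proof -
    obtain r where r: "r permutes {..<i + 1}" "sign r = sign p * (-1) ^ j * (-1) ^ p j"
      "delete_nth j (permute_list p xs) = permute_list r (delete_nth (p j) xs)"
      using delete_nth_permute_list[OF p j] len by metis
    have "f (delete_nth j (permute_list p xs)) = of_int (sign r) * f (delete_nth (p j) xs)"
      unfolding r(3) by (intro alternating_permute[OF f] delete_nth_simplices xs pj j r(1))
    then show ?thesis
      unfolding r(2) by (simp add: minus_one_power_iff)
  qed
  have "coboundary V m i f (permute_list p xs) = (\<Sum>j\<le>i + 1. (-1) ^ j * f (delete_nth j (permute_list p xs)))"
    using permute_simplices[OF xs p] by (simp add: coboundary_def)
  also have "\<dots> = (\<Sum>j\<le>i + 1. of_int (sign p) * ((-1) ^ p j * f (delete_nth (p j) xs)))"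
    by (intro sum.cong refl face_sign) simp
  also have "\<dots> = (\<Sum>j\<le>i + 1. of_int (sign p) * ((-1) ^ j * f (delete_nth j xs)))"
    using p by (intro sum.reindex_bij_betw permutes_imp_bij) (simp add: lessThan_Suc_atMost)
  also have "\<dots> = of_int (sign p) * coboundary V m i f xs"
    using xs by (simp add: coboundary_def sum_distrib_left del: sum.atMost_Suc)
  finally show "coboundary V m i f (permute_list p xs) = of_int (sign p) * coboundary V m i f xs" .
qed

lemma sum_over_neighbours_eq_degree:
  assumes "i \<le> n - 1" "ys \<in> \<Sigma> i"
  shows "(\<Sum>y\<in>common_neighbours V m ys. m (i + 1) (ys @ [y])) = m i ys * weighted_degree V m i ys"
  using weight_pos[OF assms] by (simp add: weighted_degree_def)

text \<open>
  In \<open>m\<^sub>i\<^sub>+\<^sub>1(ys, y) |f(ys)|\<^sup>2\<close> only the weight depends on \<open>y\<close>, so the sum over the common neighbours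
  \<open>y\<close> is \<open>|f(ys)|\<^sup>2\<close> times \<open>m\<^sub>i(ys)\<close> times the degree of \<open>ys\<close>. Every bound for \<open>d\<close> reduces to this.
\<close>

lemma
  assumes i: "i + 1 \<le> n - 1" and deg: "\<And>ys. ys \<in> \<Sigma> i \<Longrightarrow> weighted_degree V m i ys \<le> D"
    and f: "f \<in> ell2 V m i"
  shows face_summable: "(\<lambda>xs. m (i + 1) xs * (cmod (f (butlast xs)))\<^sup>2) summable_on \<Sigma> (i + 1)"
    and face_infsum_le: "(\<Sum>\<^sub>\<infinity>xs\<in>\<Sigma> (i + 1). m (i + 1) xs * (cmod (f (butlast xs)))\<^sup>2) \<le> D * sqnorm i f"
proof -
  let ?\<phi> = "\<lambda>xs. m (i + 1) xs * (cmod (f (butlast xs)))\<^sup>2"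
  let ?\<psi> = "\<lambda>ys. \<Sum>y\<in>common_neighbours V m ys. ?\<phi> (ys @ [y])"
  have nonneg: "?\<phi> xs \<ge> 0" if "xs \<in> \<Sigma> (i + 1)" for xs
    using weight_ge_0[OF i that] by simp
  have le: "?\<psi> ys \<le> D * (m i ys * (cmod (f ys))\<^sup>2)" if ys: "ys \<in> \<Sigma> i" for ys
  proof -
    have "?\<psi> ys = m i ys * weighted_degree V m i ys * (cmod (f ys))\<^sup>2"
      using sum_over_neighbours_eq_degree[OF _ ys] i by (simp flip: sum_distrib_right)
    also have "\<dots> \<le> m i ys * D * (cmod (f ys))\<^sup>2"
      using deg[OF ys] weight_ge_0[OF _ ys] i by (intro mult_right_mono mult_left_mono) auto
    finally show ?thesis
      by (simp add: mult_ac)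
  qed
  have summable: "(\<lambda>ys. D * (m i ys * (cmod (f ys))\<^sup>2)) summable_on \<Sigma> i"
    by (intro summable_on_cmult_right ell2_summable f)
  have "?\<psi> summable_on \<Sigma> i"
  proof (rule summable_on_comparison_test[OF summable le])
    show "0 \<le> ?\<psi> ys" if "ys \<in> \<Sigma> i" for ys
      using that snoc_simplices_iff by (intro sum_nonneg nonneg) simp
  qed
  then show \<phi>: "?\<phi> summable_on \<Sigma> (i + 1)"
    using nonneg by (rule summable_on_snoc)
  have "infsum ?\<phi> (\<Sigma> (i + 1)) = infsum ?\<psi> (\<Sigma> i)"
    by (rule infsum_snoc[OF \<phi>])
  also have "\<dots> \<le> (\<Sum>\<^sub>\<infinity>ys\<in>\<Sigma> i. D * (m i ys * (cmod (f ys))\<^sup>2))"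
    by (intro infsum_mono summable_on_fibres[OF \<phi>] summable le)
  also have "\<dots> = D * sqnorm i f"
    unfolding sqnorm_def by (intro infsum_cmult_right ell2_summable f)
  finally show "infsum ?\<phi> (\<Sigma> (i + 1)) \<le> D * sqnorm i f" .
qed

text \<open>
  One factor \<open>i + 2\<close> comes from Cauchy-Schwarz for the \<open>i + 2\<close> terms of \<open>d f\<close>, the other from adding
  up their contributions, which are equal because the weight is invariant under moving a vertex to
  the end.
\<close>

lemma coboundary_bounded:
  assumes i: "i + 1 \<le> n - 1" and deg: "\<And>ys. ys \<in> \<Sigma> i \<Longrightarrow> weighted_degree V m i ys \<le> D"
    and f: "f \<in> ell2 V m i"
  shows "coboundary V m i f \<in> ell2 V m (i + 1) \<and>
    sqnorm (i + 1) (coboundary V m i f) \<le> (real i + 2)\<^sup>2 * D * sqnorm i f"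
proof -
  let ?c = "move_to_end (i + 1)"
  let ?\<phi> = "\<lambda>xs. m (i + 1) xs * (cmod (f (butlast xs)))\<^sup>2"
  have c: "?c j permutes {..<i + 1 + 1}" if "j \<le> i + 1" for j
    using that by (rule move_to_end_permutes)
  have face: "?\<phi> (permute_list (?c j) xs) = m (i + 1) xs * (cmod (f (delete_nth j xs)))\<^sup>2"
    if xs: "xs \<in> \<Sigma> (i + 1)" and j: "j \<le> i + 1" for xs j
  proof -
    have "permute_list (?c j) xs = delete_nth j xs @ [xs ! j]"
      using xs j by (intro permute_list_move_to_end) (simp_all add: simplices_def)
    then show ?thesis
      unfolding weight_permute[OF i xs c[OF j]] by simp
  qed
  have summable_j: "(\<lambda>xs. ?\<phi> (permute_list (?c j) xs)) summable_on \<Sigma> (i + 1)"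
    and infsum_j: "(\<Sum>\<^sub>\<infinity>xs\<in>\<Sigma> (i + 1). ?\<phi> (permute_list (?c j) xs)) \<le> D * sqnorm i f"
    if "j \<le> i + 1" for j
    using summable_on_reindex_bij_betw[OF bij_betw_permute_simplices[OF c[OF that]], of ?\<phi>]
      infsum_reindex_bij_betw[OF bij_betw_permute_simplices[OF c[OF that]], of ?\<phi>]
      face_summable[OF i deg f] face_infsum_le[OF i deg f] by simp_all
  let ?\<Phi> = "\<lambda>xs. (real i + 2) * (\<Sum>j\<le>i + 1. ?\<phi> (permute_list (?c j) xs))"
  have summable: "?\<Phi> summable_on \<Sigma> (i + 1)"
    by (intro summable_on_cmult_right has_sum_imp_summable[OF has_sum_finite_sum] summable_j) auto
  have le: "m (i + 1) xs * (cmod (coboundary V m i f xs))\<^sup>2 \<le> ?\<Phi> xs" if xs: "xs \<in> \<Sigma> (i + 1)" for xs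
  proof -
    have "cmod (coboundary V m i f xs) \<le> (\<Sum>j\<le>i + 1. cmod ((-1) ^ j * f (delete_nth j xs)))"
      using xs by (simp add: coboundary_def norm_sum del: sum.atMost_Suc)
    also have "\<dots> = (\<Sum>j\<le>i + 1. cmod (f (delete_nth j xs)))"
      by (simp add: norm_mult norm_power)
    finally have "(cmod (coboundary V m i f xs))\<^sup>2 \<le> (\<Sum>j\<le>i + 1. cmod (f (delete_nth j xs)))\<^sup>2"
      by (intro power_mono) auto
    also have "\<dots> \<le> (\<Sum>j\<le>i + 1. (cmod (f (delete_nth j xs)))\<^sup>2) * real (card {..i + 1})"
      by (rule sum_squared_le_sum_of_squares)
    finally have "m (i + 1) xs * (cmod (coboundary V m i f xs))\<^sup>2
        \<le> m (i + 1) xs * ((\<Sum>j\<le>i + 1. (cmod (f (delete_nth j xs)))\<^sup>2) * real (card {..i + 1}))"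
      by (intro mult_left_mono weight_ge_0[OF i xs])
    also have "\<dots> = (real i + 2) * (\<Sum>j\<le>i + 1. m (i + 1) xs * (cmod (f (delete_nth j xs)))\<^sup>2)"
      by (simp add: sum_distrib_left[symmetric] mult_ac del: sum.atMost_Suc)
    also have "\<dots> = ?\<Phi> xs"
      by (intro arg_cong2[where f = "(*)"] refl sum.cong face[symmetric] xs) simp
    finally show ?thesis .
  qed
  have summable': "(\<lambda>xs. m (i + 1) xs * (cmod (coboundary V m i f xs))\<^sup>2) summable_on \<Sigma> (i + 1)"
    by (rule summable_on_comparison_test[OF summable le])
       (simp_all add: weight_ge_0[OF i, simplified])
  moreover have "alternating V m (i + 1) (coboundary V m i f)"
    by (intro coboundary_alternating ell2_alternating f)
  ultimately have mem: "coboundary V m i f \<in> ell2 V m (i + 1)"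
    by (simp add: ell2_def)
  have "sqnorm (i + 1) (coboundary V m i f) \<le> infsum ?\<Phi> (\<Sigma> (i + 1))"
    unfolding sqnorm_def by (intro infsum_mono summable summable' le)
  also have "\<dots> = (real i + 2) * (\<Sum>j\<le>i + 1. \<Sum>\<^sub>\<infinity>xs\<in>\<Sigma> (i + 1). ?\<phi> (permute_list (?c j) xs))"
    by (intro infsumI has_sum_cmult_right has_sum_finite_sum summable_j) auto
  also have "\<dots> \<le> (real i + 2) * (\<Sum>j\<le>i + 1. D * sqnorm i f)"
    using infsum_j by (intro mult_left_mono sum_mono) auto
  also have "\<dots> = (real i + 2)\<^sup>2 * D * sqnorm i f"
    by (simp add: power2_eq_square algebra_simps)
  finally show ?thesis
    using mem by blast
qed

text \<open>
  Cauchy-Schwarz with respect to the weights \<open>m\<^sub>i\<^sub>+\<^sub>1(ys, y)\<close> bounds \<open>|\<delta> g(ys)|\<^sup>2\<close> by the total weight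
  over \<open>y\<close>, which is \<open>m\<^sub>i(ys)\<close> times the degree, times the sum of \<open>m\<^sub>i\<^sub>+\<^sub>1 |g|\<^sup>2\<close> over the fibre.
\<close>

lemma codiff_bounded:
  assumes i: "i + 1 \<le> n - 1" and deg: "\<And>ys. ys \<in> \<Sigma> i \<Longrightarrow> weighted_degree V m i ys \<le> D"
    and g: "g \<in> ell2 V m (i + 1)"
  shows "codiff V m (i + 1) g \<in> ell2 V m i \<and>
    sqnorm i (codiff V m (i + 1) g) \<le> D * sqnorm (i + 1) g"
proof -
  let ?C = "common_neighbours V m"
  let ?\<phi> = "\<lambda>xs. m (i + 1) xs * (cmod (g xs))\<^sup>2"
  have i': "i \<le> n - 1"
    using i by simp
  note \<phi> = ell2_summable[OF g]
  have nonneg: "m (i + 1) (ys @ [y]) \<ge> 0" if "ys \<in> \<Sigma> i" "y \<in> ?C ys" for ys y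
    using that snoc_simplices_iff by (intro weight_ge_0[OF i]) simp
  have summable: "(\<lambda>ys. D * (\<Sum>y\<in>?C ys. ?\<phi> (ys @ [y]))) summable_on \<Sigma> i"
    by (intro summable_on_cmult_right summable_on_fibres[OF \<phi>])
  have le: "m i ys * (cmod (codiff V m (i + 1) g ys))\<^sup>2 \<le> D * (\<Sum>y\<in>?C ys. ?\<phi> (ys @ [y]))"
    if ys: "ys \<in> \<Sigma> i" for ys
  proof -
    let ?w = "\<lambda>y. m (i + 1) (ys @ [y])" and ?g = "\<lambda>y. g (ys @ [y])"
    have w: "?w y \<ge> 0" if "y \<in> ?C ys" for y
      using nonneg[OF ys that] .
    have pos: "m i ys > 0"
      by (rule weight_pos[OF i' ys])
    have "cmod (\<Sum>y\<in>?C ys. complex_of_real (?w y) * ?g y) \<le> (\<Sum>y\<in>?C ys. sqrt (?w y) * (sqrt (?w y) * cmod (?g y)))"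
      using w by (intro sum_norm_le) (auto simp: norm_mult mult.assoc[symmetric])
    then have "(cmod (\<Sum>y\<in>?C ys. complex_of_real (?w y) * ?g y))\<^sup>2
        \<le> (\<Sum>y\<in>?C ys. sqrt (?w y) * (sqrt (?w y) * cmod (?g y)))\<^sup>2"
      by (intro power_mono) auto
    also have "\<dots> \<le> (\<Sum>y\<in>?C ys. (sqrt (?w y))\<^sup>2) * (\<Sum>y\<in>?C ys. (sqrt (?w y) * cmod (?g y))\<^sup>2)"
      by (rule Cauchy_Schwarz_ineq_sum)
    also have "(\<Sum>y\<in>?C ys. (sqrt (?w y))\<^sup>2) = m i ys * weighted_degree V m i ys"
      using w by (subst sum_over_neighbours_eq_degree[OF i' ys, symmetric]) (intro sum.cong refl real_sqrt_pow2)
    also have "(\<Sum>y\<in>?C ys. (sqrt (?w y) * cmod (?g y))\<^sup>2) = (\<Sum>y\<in>?C ys. ?\<phi> (ys @ [y]))"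
      using w by (intro sum.cong) (auto simp: power_mult_distrib)
    also have "m i ys * weighted_degree V m i ys * (\<Sum>y\<in>?C ys. ?\<phi> (ys @ [y]))
        \<le> m i ys * D * (\<Sum>y\<in>?C ys. ?\<phi> (ys @ [y]))"
      using pos w deg[OF ys] by (intro mult_right_mono mult_left_mono sum_nonneg) auto
    finally have "(cmod (\<Sum>y\<in>?C ys. complex_of_real (?w y) * ?g y))\<^sup>2 / m i ys
        \<le> D * (\<Sum>y\<in>?C ys. ?\<phi> (ys @ [y]))"
      using pos by (simp add: divide_le_eq mult_ac)
    moreover have "m i ys * (cmod (codiff V m (i + 1) g ys))\<^sup>2
        = (cmod (\<Sum>y\<in>?C ys. complex_of_real (?w y) * ?g y))\<^sup>2 / m i ys"
      using pos ys by (subst codiff_eq) (simp_all add: norm_mult norm_divide norm_power power_mult_distrib power_divide power2_eq_square)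
    ultimately show ?thesis
      by simp
  qed
  have summable': "(\<lambda>ys. m i ys * (cmod (codiff V m (i + 1) g ys))\<^sup>2) summable_on \<Sigma> i"
    by (rule summable_on_comparison_test[OF summable le])
       (auto intro!: mult_nonneg_nonneg weight_ge_0[OF i'])
  have "codiff V m (i + 1) g \<in> ell2 V m i"
    using summable' codiff_alternating[OF i ell2_alternating[OF g]] by (simp add: ell2_def)
  moreover have "sqnorm i (codiff V m (i + 1) g) \<le> (\<Sum>\<^sub>\<infinity>ys\<in>\<Sigma> i. D * (\<Sum>y\<in>?C ys. ?\<phi> (ys @ [y])))"
    unfolding sqnorm_def by (intro infsum_mono summable summable' le)
  moreover have "\<dots> = D * sqnorm (i + 1) g"
    unfolding sqnorm_def infsum_snoc[OF \<phi>] by (intro infsum_cmult_right summable_on_fibres[OF \<phi>])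
  ultimately show ?thesis
    by simp
qed

text \<open>
  Moving vertex \<open>j\<close> to the end costs the sign \<open>(-1)\<close> to the power \<open>i + 1 - j\<close> in \<open>g\<close>, which combines
  with the sign \<open>(-1)\<^sup>j\<close> in \<open>d f\<close> to a sign independent of \<open>j\<close>, the one in the definition of \<open>\<delta>\<close>.
  So all \<open>i + 2\<close> terms agree, and this factor turns \<open>(i + 2)!\<close> of the inner product on \<open>(i + 1)\<close>-cochains
  into the \<open>(i + 1)!\<close> of the one on \<open>i\<close>-cochains.
\<close>

lemma coboundary_codiff_adjoint:
  assumes i: "i + 1 \<le> n - 1" and deg: "\<And>ys. ys \<in> \<Sigma> i \<Longrightarrow> weighted_degree V m i ys \<le> D"
    and f: "f \<in> ell2 V m i" and g: "g \<in> ell2 V m (i + 1)"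
  shows "ell2_inner V m (i + 1) g (coboundary V m i f) = ell2_inner V m i (codiff V m (i + 1) g) f"
proof -
  let ?c = "move_to_end (i + 1)"
  let ?C = "common_neighbours V m"
  let ?G = "\<lambda>xs. complex_of_real (m (i + 1) xs) * cnj (g xs) * f (butlast xs)"
  have i': "i \<le> n - 1"
    using i by simp
  have c: "?c j permutes {..<i + 1 + 1}" if "j \<le> i + 1" for j
    using that by (rule move_to_end_permutes)
  have G: "?G summable_on \<Sigma> (i + 1)"
    using weight_ge_0[OF i] by (intro weighted_product_summable ell2_summable g face_summable[OF i deg f]) auto
  have G_j: "(\<lambda>xs. ?G (permute_list (?c j) xs)) summable_on \<Sigma> (i + 1)"
    "(\<Sum>\<^sub>\<infinity>xs\<in>\<Sigma> (i + 1). ?G (permute_list (?c j) xs)) = infsum ?G (\<Sigma> (i + 1))" if "j \<le> i + 1" for j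
    using summable_on_reindex_bij_betw[OF bij_betw_permute_simplices[OF c[OF that]], of ?G]
      infsum_reindex_bij_betw[OF bij_betw_permute_simplices[OF c[OF that]], of ?G] G by simp_all
  have face: "(-1) ^ (i + 1) * ?G (permute_list (?c j) xs) =
      complex_of_real (m (i + 1) xs) * cnj (g xs) * ((-1) ^ j * f (delete_nth j xs))"
    if xs: "xs \<in> \<Sigma> (i + 1)" and j: "j \<le> i + 1" for xs j
  proof -
    have "?G (permute_list (?c j) xs) =
        complex_of_real (m (i + 1) xs) * cnj ((-1) ^ (i + 1 - j) * g xs) * f (delete_nth j xs)"
      unfolding weight_permute[OF i xs c[OF j]] alternating_permute[OF ell2_alternating[OF g] xs c[OF j]]
        sign_move_to_end[OF j]
      using permute_list_move_to_end[of xs "i + 1" j] xs j by (simp add: simplices_def)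
    then have "(-1) ^ (i + 1) * ?G (permute_list (?c j) xs) = complex_of_real (m (i + 1) xs) * cnj (g xs) *
        ((-1) ^ (i + 1) * (-1) ^ (i + 1 - j) * f (delete_nth j xs))"
      by (simp only: complex_cnj_mult complex_cnj_power complex_cnj_minus complex_cnj_one mult_ac)
    also have "(-1) ^ (i + 1) * (-1) ^ (i + 1 - j) = ((-1) ^ j :: complex)"
      using j by (simp add: minus_one_power_iff)
    finally show ?thesis .
  qed
  have "(\<Sum>\<^sub>\<infinity>xs\<in>\<Sigma> (i + 1). complex_of_real (m (i + 1) xs) * cnj (g xs) * coboundary V m i f xs) =
     (\<Sum>\<^sub>\<infinity>xs\<in>\<Sigma> (i + 1). \<Sum>j\<le>i + 1. (-1) ^ (i + 1) * ?G (permute_list (?c j) xs))"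
  proof (rule infsum_cong)
    fix xs assume xs: "xs \<in> \<Sigma> (i + 1)"
    have "complex_of_real (m (i + 1) xs) * cnj (g xs) * coboundary V m i f xs =
      (\<Sum>j\<le>i + 1. complex_of_real (m (i + 1) xs) * cnj (g xs) * ((-1) ^ j * f (delete_nth j xs)))"
      using xs by (simp add: coboundary_def sum_distrib_left del: sum.atMost_Suc)
    also have "\<dots> = (\<Sum>j\<le>i + 1. (-1) ^ (i + 1) * ?G (permute_list (?c j) xs))"
      by (intro sum.cong refl face[symmetric] xs) simp
    finally show "complex_of_real (m (i + 1) xs) * cnj (g xs) * coboundary V m i f xs =
      (\<Sum>j\<le>i + 1. (-1) ^ (i + 1) * ?G (permute_list (?c j) xs))" .
  qed
  also have "\<dots> = (\<Sum>j\<le>i + 1. \<Sum>\<^sub>\<infinity>xs\<in>\<Sigma> (i + 1). (-1) ^ (i + 1) * ?G (permute_list (?c j) xs))"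
    by (intro infsumI has_sum_finite_sum summable_on_cmult_right G_j) auto
  also have "\<dots> = (\<Sum>j\<le>i + 1. (-1) ^ (i + 1) * infsum ?G (\<Sigma> (i + 1)))"
    by (intro sum.cong refl) (simp only: infsum_cmult_right[OF G_j(1)] G_j(2) atMost_iff)
  also have "\<dots> = of_nat (i + 2) * ((-1) ^ (i + 1) * infsum ?G (\<Sigma> (i + 1)))"
    by (simp del: sum.atMost_Suc)
  also have "(-1) ^ (i + 1) * infsum ?G (\<Sigma> (i + 1)) =
      (\<Sum>\<^sub>\<infinity>ys\<in>\<Sigma> i. (-1) ^ (i + 1) * (\<Sum>y\<in>?C ys. ?G (ys @ [y])))"
    unfolding infsum_snoc[OF G] by (intro infsum_cmult_right[symmetric] summable_on_fibres[OF G])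
  also have "\<dots> = (\<Sum>\<^sub>\<infinity>ys\<in>\<Sigma> i. complex_of_real (m i ys) * cnj (codiff V m (i + 1) g ys) * f ys)"
  proof (rule infsum_cong)
    fix ys assume ys: "ys \<in> \<Sigma> i"
    have "m i ys \<noteq> 0"
      using weight_pos[OF i' ys] by simp
    then show "(-1) ^ (i + 1) * (\<Sum>y\<in>?C ys. ?G (ys @ [y])) =
        complex_of_real (m i ys) * cnj (codiff V m (i + 1) g ys) * f ys"
      by (subst codiff_eq[OF ys]) (simp flip: sum_distrib_right)
  qed
  finally have sum_eq: "(\<Sum>\<^sub>\<infinity>xs\<in>\<Sigma> (i + 1). complex_of_real (m (i + 1) xs) * cnj (g xs) * coboundary V m i f xs) =
      of_nat (i + 2) * (\<Sum>\<^sub>\<infinity>ys\<in>\<Sigma> i. complex_of_real (m i ys) * cnj (codiff V m (i + 1) g ys) * f ys)" .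
  have cancel: "1 / (c * F) * (c * R) = 1 / F * R" if "c \<noteq> 0" for c F R :: complex
    using that by simp
  have "fact (i + 1 + 1) = (of_nat (i + 2) * fact (i + 1) :: complex)"
    by simp
  moreover have "of_nat (i + 2) \<noteq> (0 :: complex)"
    by (simp only: of_nat_eq_0_iff)
  ultimately show ?thesis
    unfolding ell2_inner_def sum_eq by (simp only: cancel simp_thms)
qed

lemma coboundary_codiff_adjoint_pair:
  assumes i: "i + 1 \<le> n - 1" and "bdd_above (weighted_degree V m i ` \<Sigma> i)"
  shows "bounded_adjoint_pair (ell2 V m i) (ell2_inner V m i)
    (ell2 V m (i + 1)) (ell2_inner V m (i + 1)) (coboundary V m i) (codiff V m (i + 1))"
proof -
  obtain D where D: "weighted_degree V m i ys \<le> D" if "ys \<in> \<Sigma> i" for ys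
    using assms(2) by (auto simp: bdd_above_def)
  \<comment> \<open>If there are no \<open>i\<close>-simplices, the given bound can be negative.\<close>
  define D' where "D' = max D 0"
  have deg: "weighted_degree V m i ys \<le> D'" if "ys \<in> \<Sigma> i" for ys
    using D[OF that] by (simp add: D'_def)
  have D': "D' \<ge> 0"
    by (simp add: D'_def)
  have d: "coboundary V m i f \<in> ell2 V m (i + 1)"
    "sqnorm (i + 1) (coboundary V m i f) \<le> (real i + 2)\<^sup>2 * D' * sqnorm i f" if "f \<in> ell2 V m i" for f
    using coboundary_bounded[OF i deg that] by auto
  have \<delta>: "codiff V m (i + 1) g \<in> ell2 V m i"
    "sqnorm i (codiff V m (i + 1) g) \<le> D' * sqnorm (i + 1) g" if "g \<in> ell2 V m (i + 1)" for g
    using codiff_bounded[OF i deg that] by auto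
  show ?thesis
  proof
    show "coboundary V m i (\<lambda>x. a * f x + f' x) = (\<lambda>x. a * coboundary V m i f x + coboundary V m i f' x)" for a f f'
      by (auto simp: coboundary_def fun_eq_iff sum_distrib_left sum.distrib algebra_simps simp del: sum.atMost_Suc)
    show "codiff V m (i + 1) (\<lambda>x. a * g x + g' x) = (\<lambda>x. a * codiff V m (i + 1) g x + codiff V m (i + 1) g' x)" for a g g'
      by (auto simp: codiff_def fun_eq_iff sum_distrib_left sum.distrib algebra_simps)
    show "\<exists>C\<ge>0. \<forall>f\<in>ell2 V m i. Re (ell2_inner V m (i + 1) (coboundary V m i f) (coboundary V m i f))
        \<le> C * Re (ell2_inner V m i f f)"
    proof (intro exI conjI ballI)
      let ?C = "(real i + 2)\<^sup>2 * D' * fact (i + 1) / fact (i + 1 + 1)"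
      show "?C \<ge> 0"
        using D' by simp
      fix f assume f: "f \<in> ell2 V m i"
      show "Re (ell2_inner V m (i + 1) (coboundary V m i f) (coboundary V m i f))
        \<le> ?C * Re (ell2_inner V m i f f)"
        unfolding ell2_inner_self[OF f] ell2_inner_self[OF d(1)[OF f]]
        using divide_right_mono[OF d(2)[OF f], of "fact (i + 1 + 1)"]
        by (simp add: mult.assoc del: fact_Suc)
    qed
    show "\<exists>C\<ge>0. \<forall>g\<in>ell2 V m (i + 1). Re (ell2_inner V m i (codiff V m (i + 1) g) (codiff V m (i + 1) g))
        \<le> C * Re (ell2_inner V m (i + 1) g g)"
    proof (intro exI conjI ballI)
      let ?C = "D' * fact (i + 1 + 1) / fact (i + 1)"
      show "?C \<ge> 0"
        using D' by simp
      fix g assume g: "g \<in> ell2 V m (i + 1)"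
      show "Re (ell2_inner V m i (codiff V m (i + 1) g) (codiff V m (i + 1) g))
        \<le> ?C * Re (ell2_inner V m (i + 1) g g)"
        unfolding ell2_inner_self[OF g] ell2_inner_self[OF \<delta>(1)[OF g]]
        using divide_right_mono[OF \<delta>(2)[OF g], of "fact (i + 1)"]
        by (simp add: mult.assoc del: fact_Suc)
    qed
  qed (use d(1) \<delta>(1) coboundary_codiff_adjoint[OF i deg] in blast)+
qed

section \<open>Essential self-adjointness of the Laplacian\<close>

text \<open>
  At the two ends \<open>l = 0\<close> and \<open>l = n - 1\<close> the missing half of \<open>L\<close> is the zero operator, which matches
  the cases where no degree bound is assumed.
\<close>

lemma laplacian_bounded_symmetric:
  assumes l: "l \<le> n - 1"
    and down: "l \<ge> 1 \<Longrightarrow> bdd_above (weighted_degree V m (l - 1) ` \<Sigma> (l - 1))"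
    and up: "l \<le> n - 2 \<Longrightarrow> bdd_above (weighted_degree V m l ` \<Sigma> l)"
  shows "bounded_symmetric (ell2 V m l) (ell2_inner V m l) (laplacian V n m l)"
proof -
  interpret function_inner_product "ell2 V m l" "ell2_inner V m l"
    by (rule ell2_inner_product[OF l])
  have down': "bounded_symmetric (ell2 V m l) (ell2_inner V m l)
      (\<lambda>f xs. if l = 0 then 0 else coboundary V m (l - 1) (codiff V m l f) xs)"
  proof (cases "l = 0")
    case True
    then show ?thesis
      using bounded_symmetric_zero by simp
  next
    case False
    then have pair: "bounded_adjoint_pair (ell2 V m (l - 1)) (ell2_inner V m (l - 1))
        (ell2 V m l) (ell2_inner V m l) (coboundary V m (l - 1)) (codiff V m l)"
      using coboundary_codiff_adjoint_pair[of "l - 1"] down l by simp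
    have "function_inner_product (ell2 V m (l - 1)) (ell2_inner V m (l - 1))"
      using l by (intro ell2_inner_product) simp
    then have "bounded_adjoint_pair (ell2 V m l) (ell2_inner V m l)
        (ell2 V m (l - 1)) (ell2_inner V m (l - 1)) (codiff V m l) (coboundary V m (l - 1))"
      using function_inner_product_axioms pair by (rule bounded_adjoint_pair_swap)
    from bounded_adjoint_pair_compose[OF this pair] False show ?thesis
      by simp
  qed
  have up': "bounded_symmetric (ell2 V m l) (ell2_inner V m l)
      (\<lambda>f xs. if l = n - 1 then 0 else codiff V m (l + 1) (coboundary V m l f) xs)"
  proof (cases "l = n - 1")
    case True
    then show ?thesis
      using bounded_symmetric_zero by simp
  next
    case False
    with l n_ge_2 have l': "l + 1 \<le> n - 1" "l \<le> n - 2"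
      by auto
    note pair = coboundary_codiff_adjoint_pair[OF l'(1) up[OF l'(2)]]
    have "bounded_adjoint_pair (ell2 V m (l + 1)) (ell2_inner V m (l + 1))
        (ell2 V m l) (ell2_inner V m l) (codiff V m (l + 1)) (coboundary V m l)"
      by (rule bounded_adjoint_pair_swap[OF function_inner_product_axioms ell2_inner_product[OF l'(1)] pair])
    from bounded_adjoint_pair_compose[OF pair this] False show ?thesis
      by simp
  qed
  have "laplacian V n m l = (\<lambda>f xs.
     (if l = 0 then 0 else coboundary V m (l - 1) (codiff V m l f) xs) +
     (if l = n - 1 then 0 else codiff V m (l + 1) (coboundary V m l f) xs))"
    by (intro ext) (simp only: laplacian_def)
  then show ?thesis
    using bounded_symmetric_add[OF down' up'] by (simp only:)
qed

end

theorem theorem4p13: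
  fixes V :: "'v set"
    and n l :: nat
    and m :: "nat \<Rightarrow> 'v list \<Rightarrow> real"
    and Pos :: "nat \<Rightarrow> 'v list set set"
  assumes "weighted_oriented_complex V n m Pos"
    and "locally_finite_complex V m"
    and "l \<le> n - 1"
    and "l \<ge> 1 \<Longrightarrow> bdd_above (weighted_degree V m (l - 1) ` simplices V m (l - 1))"
    and "l \<le> n - 2 \<Longrightarrow> bdd_above (weighted_degree V m l ` simplices V m l)"
  shows "((\<exists>Ok chi. exhaustion_with_cutoffs V Ok chi) \<longrightarrow>
           essentially_self_adjoint_on (ell2 V m l) (ell2_inner V m l)
             (Cc V m l) (laplacian V n m l)) \<and>
         (1 \<le> l \<and> locally_chi_complete V m Pos l \<longrightarrow>
           essentially_self_adjoint_on (ell2 V m l) (ell2_inner V m l)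
             (Cc V m l) (laplacian V n m l))"
proof -
  interpret weighted_oriented_complex V n m Pos
    by (rule assms(1))
  interpret locally_finite_weighted_complex V n m Pos
    by unfold_locales (rule assms(2))
  interpret function_inner_product "ell2 V m l" "ell2_inner V m l"
    by (rule ell2_inner_product[OF assms(3)])
  have main: "essentially_self_adjoint_on (ell2 V m l) (ell2_inner V m l) (Cc V m l) (laplacian V n m l)"
    if "exhaustion_with_cutoffs V Ok chi" for Ok chi
  proof (rule bounded_symmetric_essentially_self_adjoint)
    show "bounded_symmetric (ell2 V m l) (ell2_inner V m l) (laplacian V n m l)"
      using assms(3-5) by (rule laplacian_bounded_symmetric)
    show "dense_subset (ell2 V m l) (ell2_inner V m l) (Cc V m l)"
      using that by (intro Cc_dense[OF assms(3), of Ok]) (auto simp: exhaustion_with_cutoffs_def)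
    show "(\<lambda>xs. 0) \<in> Cc V m l"
      by (simp add: Cc_def alternating_zero)
  qed (rule Cc_lin)
  then show ?thesis
    unfolding locally_chi_complete_def by blast
qed

end
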